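(* Let $C>0$ be a constant, let $H=H_n$ be a clique of size $C\sqrt n$ (rounded to an integer), and let $p=1/2$. Consider the planted subgraph detection task where $H$ is planted in $G(n,p)$. Then for any $t=t_n\ge1$ (potentially growing with $n$), counting $t$-stars fails to achieve strong separation, i.e. the signed count $f_{\mathbf{K}_{1,t}}$ does not strongly separate $\mathbb{P}$ and $\mathbb{Q}$. Yet, for all large enough $C>0$, some polynomial of degree $O(\log n)$ achieves strong separation between $\mathbb{P}$ and $\mathbb{Q}$.
   Context: Asymptotics are as $n\to\infty$. $a_n=o(b_n)$ means $a_n/b_n\to0$ (in particular $b_n\neq 0$ for large $n$). Graphs on vertex set $[n]$ are identified with vectors $G=(G_{\{i,j\}})\in\{0,1\}^{\binom n2}$ of edge indicators. $G(n,p)$ is the Erdős–Rényi random graph. Planted subgraph detection task: under the null $\mathbb{Q}=G(n,p)$ one observes $G(n,p)$; under $\mathbb{P}$ one observes the union of $G(n,p)$ with an independent random copy of $H$, chosen uniformly among all labelled copies of $H$ in the complete graph $K_n$ (i.e. the image of $H$ under a uniformly random injection $V(H)\to[n]$). A (sequence of) polynomial(s) $f$ in the $\binom n2$ variables $G_{\{i,j\}}$ strongly separates $\mathbb{P}$ and $\mathbb{Q}$ if $\max\{\sqrt{\mathrm{Var}_{\mathbb{P}}(f)},\sqrt{\mathrm{Var}_{\mathbb{Q}}(f)}\}=o(|\mathbb{E}_{\mathbb{P}}f-\mathbb{E}_{\mathbb{Q}}f|)$. For $S\subseteq\binom{[n]}{2}$, $\chi_S(G)=\prod_{\{i,j\}\in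 S}\frac{G_{\{i,j\}}-p}{\sqrt{p(1-p)}}$. For a graph $\mathbf{S}$ without isolated vertices, its signed count is $f_{\mathbf{S}}(G)=\sum_{S\subseteq\binom{[n]}{2}:\,S\cong\mathbf{S}}\chi_S(G)$. $\mathbf{K}_{1,t}$ is the star with $t$ edges. *)

theory Defs
  imports "HOL-Probability.Probability" "HOL-Probability.Product_PMF"
    "HOL-Library.Poly_Mapping" "HOL-Library.Landau_Symbols"
begin

text \<open>Graphs on \<open>[n] = {1..n}\<close> are edge-indicator vectors, of type \<^typ>\<open>nat set \<Rightarrow> bool\<close>,
  that are \<^term>\<open>False\<close> outside \<open>all_edges {1..n}\<close>.\<close>

definition all_edges :: "'a set \<Rightarrow> 'a set set" where
  "all_edges V = {e. e \<subseteq> V \<and> card e = 2}"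

definition gnp :: "nat \<Rightarrow> real \<Rightarrow> (nat set \<Rightarrow> bool) pmf" where
  "gnp n p = Pi_pmf (all_edges {1..n}) False (\<lambda>_. bernoulli_pmf p)"

text \<open>The planted graph \<open>H\<close> has vertex set \<open>V\<close> and edge set \<open>E\<close>. If \<open>card V > n\<close> there is no
  injection and \<open>planted\<close> is unspecified; for a fixed \<open>C\<close> and \<open>card V\<close> about \<open>C * sqrt n\<close> this
  concerns only finitely many \<open>n\<close>.\<close>

definition planted :: "nat \<Rightarrow> real \<Rightarrow> 'a set \<Rightarrow> 'a set set \<Rightarrow> (nat set \<Rightarrow> bool) pmf" where
  "planted n p V E =
     map_pmf (\<lambda>(G, \<phi>). \<lambda>e. G e \<or> e \<in> (`) \<phi> ` E)
       (pair_pmf (gnp n p) (pmf_of_set {\<phi> \<in> V \<rightarrow>\<^sub>E {1..n}. inj_on \<phi> V}))"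

definition planted_clique :: "nat \<Rightarrow> real \<Rightarrow> nat \<Rightarrow> (nat set \<Rightarrow> bool) pmf" where
  "planted_clique n p k = planted n p {..<k} (all_edges {..<k})"

text \<open>The explicit nonvanishing condition matters because \<open>x / 0 = 0\<close>: a statistic that is
  constant under both distributions must not count as separating.\<close>

definition strongly_separates ::
  "(nat \<Rightarrow> 'g pmf) \<Rightarrow> (nat \<Rightarrow> 'g pmf) \<Rightarrow> (nat \<Rightarrow> 'g \<Rightarrow> real) \<Rightarrow> bool" where
  "strongly_separates P Q f \<longleftrightarrow>
     (let a = (\<lambda>n. max (sqrt (measure_pmf.variance (P n) (f n)))
                       (sqrt (measure_pmf.variance (Q n) (f n))));
          b = (\<lambda>n. \<bar>measure_pmf.expectation (P n) (f n) - measure_pmf.expectation (Q n) (f n)\<bar>)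
      in (\<forall>\<^sub>F n in sequentially. b n \<noteq> 0) \<and> (\<lambda>n. a n / b n) \<longlonglongrightarrow> 0)"

definition chi :: "real \<Rightarrow> nat set set \<Rightarrow> (nat set \<Rightarrow> bool) \<Rightarrow> real" where
  "chi p S G = (\<Prod>e\<in>S. (of_bool (G e) - p) / sqrt (p * (1 - p)))"

text \<open>A graph without isolated vertices is given by its edge set alone, its vertex set being the
  union of the edges.\<close>

definition edge_iso :: "'a set set \<Rightarrow> 'b set set \<Rightarrow> bool" where
  "edge_iso S T \<longleftrightarrow> (\<exists>\<phi>. bij_betw \<phi> (\<Union>S) (\<Union>T) \<and> (`) \<phi> ` S = T)"

definition signed_count :: "nat \<Rightarrow> real \<Rightarrow> 'a set set \<Rightarrow> (nat set \<Rightarrow> bool) \<Rightarrow> real" where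
  "signed_count n p T G = (\<Sum>S | S \<subseteq> all_edges {1..n} \<and> edge_iso S T. chi p S G)"

definition star :: "nat \<Rightarrow> nat set set" where
  "star t = {{0, i} | i. i \<in> {1..t}}"

text \<open>Real multivariate polynomials with variables indexed by \<open>'v\<close>: a monomial is a finitely
  supported exponent vector.\<close>

type_synonym 'v mvpoly = "('v \<Rightarrow>\<^sub>0 nat) \<Rightarrow>\<^sub>0 real"

definition mv_vars :: "'v mvpoly \<Rightarrow> 'v set" where
  "mv_vars q = (\<Union>m\<in>Poly_Mapping.keys q. Poly_Mapping.keys m)"

text \<open>Total degree; the zero polynomial has degree 0.\<close>

definition mv_degree :: "'v mvpoly \<Rightarrow> nat" where
  "mv_degree q =
     Max (insert 0 ((\<lambda>m. \<Sum>v\<in>Poly_Mapping.keys m. Poly_Mapping.lookup m v) ` Poly_Mapping.keys q))"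

definition mv_eval :: "'v mvpoly \<Rightarrow> ('v \<Rightarrow> real) \<Rightarrow> real" where
  "mv_eval q x = (\<Sum>m\<in>Poly_Mapping.keys q. Poly_Mapping.lookup q m *
     (\<Prod>v\<in>Poly_Mapping.keys m. x v ^ Poly_Mapping.lookup m v))"

text \<open>\<open>k n\<close> is \<open>C * sqrt n\<close> rounded to an integer; rounding down, up or to the nearest integer
  are all allowed.\<close>

definition clique_size :: "real \<Rightarrow> (nat \<Rightarrow> nat) \<Rightarrow> bool" where
  "clique_size C k \<longleftrightarrow> (\<forall>n. \<bar>real (k n) - C * sqrt (real n)\<bar> < 1)"

end

theory Submission
  imports Defs "HOL-Real_Asymp.Real_Asymp"
begin

text \<open>
  For \<open>p = 1/2\<close> the character \<open>\<chi>\<^sub>S\<close> is a product of independent signs, one for each edge of \<open>S\<close>.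
  If the clique is planted on a fixed vertex set, with edge set \<open>K\<close>, the signs on \<open>K\<close> become 1 and the
  others stay random. Hence the mean of \<open>\<chi>\<^sub>S\<close> is 1 if \<open>S \<subseteq> K\<close> and 0 otherwise, and for a sum of characters
  over a family of edge sets the variance is the number of pairs \<open>(S, T)\<close> in the family with
  \<open>S - K = T - K \<noteq> {}\<close> (\<open>variance_sum_chi_planted\<close>). Under the null, \<open>K\<close> is empty. Both halves of
  the theorem are thereby reduced to counting.

  \<^bold>\<open>Stars fail.\<close> The shift of the mean is the number \<open>M\<close> of \<open>t\<close>-stars in a set of \<open>k\<close> vertices, and
  the null variance is the number \<open>N\<close> of \<open>t\<close>-stars in \<open>[n]\<close>. Roughly \<open>M = k ^ (t + 1) / fact t\<close> and
  \<open>N = n ^ (t + 1) / fact t\<close>, so with \<open>D = k\<^sup>2 / n\<close>, which is bounded, \<open>M\<^sup>2 / N\<close> is about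
  \<open>D ^ (t + 1) / fact t\<close> and never exceeds a constant, however \<open>t\<close> is chosen
  (\<open>card_stars_square_le\<close>): the large automorphism group of the star cancels the exponential gain.

  \<^bold>\<open>Paths succeed.\<close> A path has only two automorphisms. Sum the characters of all labelled paths on
  \<open>v\<close> vertices. Its conditional mean is the falling factorial of \<open>k\<close>, at least \<open>(k/2) ^ v\<close> when \<open>2 v \<le> k\<close>,
  for every placement of the clique, so the placement adds no variance. In a pair of paths with the
  same nonempty random part, either both paths avoid the clique and have the same edges, or the pair
  shares all vertices outside the clique and also a vertex inside it. The former contribute at most
  \<open>v n ^ v\<close>, exponentially smaller than \<open>(k/2) ^ (2 v)\<close> once \<open>C\<close> is large; for the latter the
  additional shared vertex saves a factor \<open>k\<close>, leaving at most \<open>(4 v) ^ v * k ^ (2 v - 1)\<close>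
  (\<open>card_path_pairs_le\<close>). A slowly growing \<open>v\<close>, here the integer part of \<open>sqrt (ln n)\<close>, makes both
  negligible, and the degree is at most \<open>v\<close>.
\<close>

section \<open>Characters of a graph with a planted edge set\<close>

lemma finite_all_edges: "finite V \<Longrightarrow> finite (all_edges V)"
  unfolding all_edges_def by (rule finite_subset[of _ "Pow V"]) auto

lemma all_edges_mono: "V \<subseteq> W \<Longrightarrow> all_edges V \<subseteq> all_edges W"
  unfolding all_edges_def by auto

lemma finite_set_pmf_gnp: "finite (set_pmf (gnp n p))"
  unfolding gnp_def
  by (subst set_Pi_pmf) (auto intro!: finite_PiE_dflt finite_all_edges)

lemma chi_half: "chi (1/2) S G = (\<Prod>e\<in>S. 2 * of_bool (G e) - 1)"
proof -
  have "sqrt (1/2 * (1 - 1/2)) = (1/2 :: real)"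
    by (rule real_sqrt_unique) (auto simp: power2_eq_square)
  then show ?thesis
    unfolding chi_def by (intro prod.cong) (auto simp: field_simps)
qed

lemma chi_half_times:
  assumes "finite S" "finite T"
  shows "chi (1/2) S G * chi (1/2) T G = chi (1/2) ((S - T) \<union> (T - S)) G"
proof -
  let ?s = "\<lambda>e. 2 * of_bool (G e) - 1 :: real"
  have sq: "?s e * ?s e = 1" for e by auto
  have S: "prod ?s S = prod ?s (S - T) * prod ?s (S \<inter> T)"
    using prod.Int_Diff[OF assms(1), of ?s T] by (simp add: mult.commute)
  have T: "prod ?s T = prod ?s (T - S) * prod ?s (S \<inter> T)"
    using prod.Int_Diff[OF assms(2), of ?s S] by (simp add: mult.commute Int_commute)
  have "prod ?s (S \<inter> T) * prod ?s (S \<inter> T) = 1"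
    by (simp add: sq flip: prod.distrib)
  then have "prod ?s S * prod ?s T = prod ?s (S - T) * prod ?s (T - S)"
    unfolding S T by (simp add: mult.assoc mult.left_commute)
  also have "\<dots> = prod ?s ((S - T) \<union> (T - S))"
    using assms by (subst prod.union_disjoint) auto
  finally show ?thesis unfolding chi_half .
qed

text \<open>An edge of \<open>S\<close> outside \<open>K\<close> is a fair coin, and flipping it flips the sign of \<open>\<chi>\<^sub>S\<close>;
  edges inside \<open>K\<close> contribute the factor 1.\<close>

lemma expectation_chi_planted:
  assumes S: "S \<subseteq> all_edges {1..n}"
  shows "measure_pmf.expectation (gnp n (1/2)) (\<lambda>G. chi (1/2) S (\<lambda>e. G e \<or> e \<in> K))
         = of_bool (S \<subseteq> K)"
proof (cases "S \<subseteq> K")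
  case True
  then have "chi (1/2) S (\<lambda>e. G e \<or> e \<in> K) = 1" for G
    unfolding chi_half by (intro prod.neutral) auto
  with True show ?thesis by simp
next
  case False
  then obtain e where e: "e \<in> S" "e \<notin> K" by auto
  define B where "B = all_edges {1..n} - {e}"
  let ?P = "Pi_pmf B False (\<lambda>_. bernoulli_pmf (1/2))"
  let ?h = "\<lambda>G. chi (1/2) S (\<lambda>e. G e \<or> e \<in> K)"
  have fin: "finite S" "finite B"
    using finite_subset[OF S] by (auto simp: B_def finite_all_edges)
  have split: "all_edges {1..n} = insert e B"
    using e S by (auto simp: B_def)
  have flip: "?h (f(e := True)) = - ?h (f(e := False))" for f
  proof -
    have "(\<Prod>d\<in>S - {e}. 2 * of_bool ((f(e := True)) d \<or> d \<in> K) - 1 :: real)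
        = (\<Prod>d\<in>S - {e}. 2 * of_bool ((f(e := False)) d \<or> d \<in> K) - 1)"
      by (intro prod.cong) auto
    then show ?thesis
      using e fin unfolding chi_half by (simp add: prod.remove[of S e])
  qed
  have "gnp n (1/2) = bernoulli_pmf (1/2) \<bind> (\<lambda>b. map_pmf (\<lambda>f. f(e := b)) ?P)"
    unfolding gnp_def split using fin
    by (subst Pi_pmf_insert') (auto simp: B_def map_pmf_def)
  then have "measure_pmf.expectation (gnp n (1/2)) ?h
      = (\<Sum>b\<in>UNIV. pmf (bernoulli_pmf (1/2)) b *\<^sub>R
           measure_pmf.expectation (map_pmf (\<lambda>f. f(e := b)) ?P) ?h)"
    using fin by (simp only:, subst pmf_expectation_bind[where A = UNIV])
       (auto simp: set_Pi_pmf intro!: finite_PiE_dflt)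
  also have "\<dots> = 0"
    by (simp add: UNIV_bool flip del: fun_upd_apply)
  finally show ?thesis using False by simp
qed

text \<open>Since \<open>\<chi>\<^sub>S \<chi>\<^sub>T\<close> is \<open>\<chi>\<close> of the symmetric difference, planting makes two characters
  correlated precisely when \<open>S\<close> and \<open>T\<close> have the same random part.\<close>

lemma expectation_chi_planted_times:
  assumes "S \<subseteq> all_edges {1..n}" "T \<subseteq> all_edges {1..n}"
  shows "measure_pmf.expectation (gnp n (1/2))
           (\<lambda>G. chi (1/2) S (\<lambda>e. G e \<or> e \<in> K) * chi (1/2) T (\<lambda>e. G e \<or> e \<in> K))
         = of_bool (S - K = T - K)"
proof -
  have "finite S" "finite T"
    using assms finite_subset finite_all_edges by blast+
  then have "measure_pmf.expectation (gnp n (1/2))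
           (\<lambda>G. chi (1/2) S (\<lambda>e. G e \<or> e \<in> K) * chi (1/2) T (\<lambda>e. G e \<or> e \<in> K))
         = of_bool ((S - T) \<union> (T - S) \<subseteq> K)"
    using assms by (simp only: chi_half_times) (intro expectation_chi_planted, auto)
  also have "((S - T) \<union> (T - S) \<subseteq> K) = (S - K = T - K)" by auto
  finally show ?thesis .
qed

lemma expectation_sum_chi_planted:
  assumes "finite X" and S: "\<And>x. x \<in> X \<Longrightarrow> S x \<subseteq> all_edges {1..n}"
  shows "measure_pmf.expectation (gnp n (1/2)) (\<lambda>G. \<Sum>x\<in>X. chi (1/2) (S x) (\<lambda>e. G e \<or> e \<in> K))
         = real (card {x \<in> X. S x \<subseteq> K})"
proof -
  have "measure_pmf.expectation (gnp n (1/2)) (\<lambda>G. \<Sum>x\<in>X. chi (1/2) (S x) (\<lambda>e. G e \<or> e \<in> K))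
      = (\<Sum>x\<in>X. of_bool (S x \<subseteq> K))"
    by (subst Bochner_Integration.integral_sum)
       (auto intro!: integrable_measure_pmf_finite finite_set_pmf_gnp sum.cong
             simp: expectation_chi_planted[OF S])
  also have "\<dots> = real (card {x \<in> X. S x \<subseteq> K})"
    using assms(1) by (simp add: Int_def)
  finally show ?thesis .
qed

text \<open>The second moment counts the pairs with equal random part. Those whose random part is empty form the
  product of the set counted by the mean with itself, so subtracting the squared mean removes
  exactly them. This turns every variance below into a counting problem.\<close>

lemma variance_sum_chi_planted:
  assumes X: "finite X" and S: "\<And>x. x \<in> X \<Longrightarrow> S x \<subseteq> all_edges {1..n}"
  shows "measure_pmf.variance (gnp n (1/2)) (\<lambda>G. \<Sum>x\<in>X. chi (1/2) (S x) (\<lambda>e. G e \<or> e \<in> K))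
         = real (card {(x, y) \<in> X \<times> X. S x - K = S y - K \<and> \<not> S x \<subseteq> K})"
proof -
  let ?F = "\<lambda>G. \<Sum>x\<in>X. chi (1/2) (S x) (\<lambda>e. G e \<or> e \<in> K)"
  let ?E = "measure_pmf.expectation (gnp n (1/2))"
  let ?in = "{x \<in> X. S x \<subseteq> K}"
  let ?all = "{(x, y) \<in> X \<times> X. S x - K = S y - K}"
  let ?out = "{(x, y) \<in> X \<times> X. S x - K = S y - K \<and> \<not> S x \<subseteq> K}"
  have int: "integrable (gnp n (1/2)) f" for f :: "_ \<Rightarrow> real"
    by (intro integrable_measure_pmf_finite finite_set_pmf_gnp)
  have "?E (\<lambda>G. (?F G)\<^sup>2)
      = (\<Sum>(x, y)\<in>X \<times> X. ?E (\<lambda>G. chi (1/2) (S x) (\<lambda>e. G e \<or> e \<in> K) * chi (1/2) (S y) (\<lambda>e. G e \<or> e \<in> K)))"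
    unfolding power2_eq_square sum_product sum.cartesian_product
    by (subst Bochner_Integration.integral_sum) (auto intro!: int sum.cong)
  also have "\<dots> = (\<Sum>(x, y)\<in>X \<times> X. of_bool (S x - K = S y - K))"
    by (intro sum.cong) (auto simp: expectation_chi_planted_times[OF S S])
  also have "\<dots> = (\<Sum>z\<in>X \<times> X. of_bool (S (fst z) - K = S (snd z) - K))"
    by (intro sum.cong) auto
  also have "\<dots> = real (card ?all)"
    using X by (simp add: Int_def) (intro arg_cong[where f = card], auto)
  finally have sq: "?E (\<lambda>G. (?F G)\<^sup>2) = real (card ?all)" .
  have "?all = ?out \<union> ?in \<times> ?in" "?out \<inter> ?in \<times> ?in = {}" by auto
  moreover have "finite ?out" "finite (?in \<times> ?in)"
    using X by (auto intro: finite_subset[of _ "X \<times> X"])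
  ultimately have "card ?all = card ?out + card ?in * card ?in"
    by (simp only: card_Un_disjoint card_cartesian_product)
  moreover have "measure_pmf.variance (gnp n (1/2)) ?F = ?E (\<lambda>G. (?F G)\<^sup>2) - (?E ?F)\<^sup>2"
    by (intro measure_pmf.variance_eq int)
  moreover have "?E ?F = real (card ?in)"
    by (rule expectation_sum_chi_planted[OF X S])
  ultimately show ?thesis using sq by (simp add: power2_eq_square)
qed

lemma variance_sum_chi_gnp:
  assumes "finite X" and "\<And>x. x \<in> X \<Longrightarrow> S x \<subseteq> all_edges {1..n}" "\<And>x. x \<in> X \<Longrightarrow> S x \<noteq> {}"
  shows "measure_pmf.expectation (gnp n (1/2)) (\<lambda>G. \<Sum>x\<in>X. chi (1/2) (S x) G) = 0"
    and "measure_pmf.variance (gnp n (1/2)) (\<lambda>G. \<Sum>x\<in>X. chi (1/2) (S x) G)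
         = real (card {(x, y) \<in> X \<times> X. S x = S y})"
proof -
  have "{x \<in> X. S x = {}} = {}" using assms(3) by auto
  then show "measure_pmf.expectation (gnp n (1/2)) (\<lambda>G. \<Sum>x\<in>X. chi (1/2) (S x) G) = 0"
    using expectation_sum_chi_planted[where X = X and S = S and K = "{}", OF assms(1,2)]
    by (simp del: Collect_empty_eq)
  have "{(x, y) \<in> X \<times> X. S x - {} = S y - {} \<and> \<not> S x \<subseteq> {}} = {(x, y) \<in> X \<times> X. S x = S y}"
    using assms(3) by auto
  then show "measure_pmf.variance (gnp n (1/2)) (\<lambda>G. \<Sum>x\<in>X. chi (1/2) (S x) G)
         = real (card {(x, y) \<in> X \<times> X. S x = S y})"
    using variance_sum_chi_planted[where X = X and S = S and K = "{}", OF assms(1,2)] by simp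
qed

section \<open>Averaging over the placement of the clique\<close>

lemma image_all_edges:
  assumes "inj_on \<phi> V"
  shows "(`) \<phi> ` all_edges V = all_edges (\<phi> ` V)"
proof (intro equalityI subsetI)
  fix e assume "e \<in> (`) \<phi> ` all_edges V"
  then obtain d where "e = \<phi> ` d" "d \<subseteq> V" "card d = 2" by (auto simp: all_edges_def)
  then show "e \<in> all_edges (\<phi> ` V)"
    using assms by (auto simp: all_edges_def card_image inj_on_subset)
next
  fix e assume "e \<in> all_edges (\<phi> ` V)"
  then obtain d where "e = \<phi> ` d" "d \<subseteq> V" "card e = 2"
    by (auto simp: all_edges_def subset_image_iff)
  then show "e \<in> (`) \<phi> ` all_edges V"
    using assms by (auto simp: all_edges_def card_image inj_on_subset)
qed

lemma clique_placements_nonempty: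
  fixes k n :: nat
  assumes "k \<le> n"
  shows "{\<phi> \<in> {..<k} \<rightarrow>\<^sub>E {1..n}. inj_on \<phi> {..<k}} \<noteq> {}"
proof -
  have "inj_on (restrict Suc {..<k}) {..<k}" "restrict Suc {..<k} \<in> {..<k} \<rightarrow>\<^sub>E {1..n}"
    using assms by (auto simp: inj_on_def)
  then show ?thesis by blast
qed

text \<open>The planted law is the average, over the placements of the clique, of \<open>G(n,p)\<close> with a fixed
  clique added, so a bound that is uniform in the vertex set \<open>W\<close> of the clique carries over.\<close>

lemma expectation_planted_clique_le:
  fixes h :: "(nat set \<Rightarrow> bool) \<Rightarrow> real"
  assumes "k \<le> n"
    and le: "\<And>W. W \<subseteq> {1..n} \<Longrightarrow> card W = k \<Longrightarrow>
      measure_pmf.expectation (gnp n p) (\<lambda>G. h (\<lambda>e. G e \<or> e \<in> all_edges W)) \<le> c"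
  shows "measure_pmf.expectation (planted_clique n p k) h \<le> c"
proof -
  let ?\<Phi> = "{\<phi> \<in> {..<k} \<rightarrow>\<^sub>E {1..n}. inj_on \<phi> {..<k}}"
  let ?f = "\<lambda>\<phi>. map_pmf (\<lambda>G e. G e \<or> e \<in> (`) \<phi> ` all_edges {..<k}) (gnp n p)"
  have ne: "?\<Phi> \<noteq> {}" by (rule clique_placements_nonempty[OF assms(1)])
  have fin: "finite ?\<Phi>"
    by (rule finite_subset[of _ "{..<k} \<rightarrow>\<^sub>E {1..n}"]) (auto intro!: finite_PiE)
  have "planted_clique n p k = pmf_of_set ?\<Phi> \<bind> ?f"
    unfolding planted_clique_def planted_def pair_pmf_def
    by (subst bind_commute_pmf) (simp add: map_pmf_def bind_assoc_pmf bind_return_pmf)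
  then have "measure_pmf.expectation (planted_clique n p k) h
      = (\<Sum>\<phi>\<in>?\<Phi>. measure_pmf.expectation (?f \<phi>) h /\<^sub>R real (card ?\<Phi>))"
    using pmf_expectation_bind_pmf_of_set[OF ne fin, of ?f h] by (simp add: finite_set_pmf_gnp)
  also have "\<dots> \<le> (\<Sum>\<phi>\<in>?\<Phi>. c /\<^sub>R real (card ?\<Phi>))"
  proof (intro sum_mono scaleR_left_mono)
    fix \<phi> assume \<phi>: "\<phi> \<in> ?\<Phi>"
    then have "\<phi> ` {..<k} \<subseteq> {1..n}" "card (\<phi> ` {..<k}) = k"
      by (auto simp: card_image)
    then show "measure_pmf.expectation (?f \<phi>) h \<le> c"
      using \<phi> le by (simp add: image_all_edges)
  qed auto
  also have "\<dots> = c" using ne fin by simp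
  finally show ?thesis .
qed

lemma expectation_planted_clique_eq:
  fixes h :: "(nat set \<Rightarrow> bool) \<Rightarrow> real"
  assumes "k \<le> n"
    and "\<And>W. W \<subseteq> {1..n} \<Longrightarrow> card W = k \<Longrightarrow>
      measure_pmf.expectation (gnp n p) (\<lambda>G. h (\<lambda>e. G e \<or> e \<in> all_edges W)) = c"
  shows "measure_pmf.expectation (planted_clique n p k) h = c"
  using expectation_planted_clique_le[OF assms(1), of p h c]
    expectation_planted_clique_le[OF assms(1), of p "\<lambda>G. - h G" "- c"] assms(2)
  by (simp add: antisym)

text \<open>When the conditional mean is the same for every placement, the law of total variance has no
  between-placements term.\<close>

lemma variance_planted_clique_le:
  fixes h :: "(nat set \<Rightarrow> bool) \<Rightarrow> real"
  assumes "k \<le> n"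
    and E: "\<And>W. W \<subseteq> {1..n} \<Longrightarrow> card W = k \<Longrightarrow>
      measure_pmf.expectation (gnp n p) (\<lambda>G. h (\<lambda>e. G e \<or> e \<in> all_edges W)) = \<mu>"
    and V: "\<And>W. W \<subseteq> {1..n} \<Longrightarrow> card W = k \<Longrightarrow>
      measure_pmf.variance (gnp n p) (\<lambda>G. h (\<lambda>e. G e \<or> e \<in> all_edges W)) \<le> v"
  shows "measure_pmf.variance (planted_clique n p k) h \<le> v"
proof -
  have "measure_pmf.expectation (planted_clique n p k) h = \<mu>"
    using expectation_planted_clique_eq[OF assms(1) E] .
  then show ?thesis
    using expectation_planted_clique_le[OF assms(1), of p "\<lambda>G. (h G - \<mu>)\<^sup>2" v] E V by simp
qed

section \<open>Counting stars\<close>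

text \<open>Copies of the star are parametrised by a centre and a set of leaves. The parametrisation is
  two-to-one for \<open>t = 1\<close>, so only an upper bound and a lower bound up to a factor 2 are drawn
  from it; this treats all \<open>t\<close> alike.\<close>

lemma stars_eq_image:
  assumes "t \<ge> 1"
  shows "{S. S \<subseteq> all_edges V \<and> edge_iso S (star t)}
       = (\<lambda>(c, L). (\<lambda>l. {c, l}) ` L) ` (SIGMA c:V. {L. L \<subseteq> V - {c} \<and> card L = t})"
proof (intro equalityI subsetI)
  have star: "star t = (\<lambda>i. {0, i}) ` {1..t}" by (auto simp: star_def)
  have Union_star: "\<Union>(star t) = {0..t}" using assms by (auto simp: star)
  {
    fix S assume "S \<in> {S. S \<subseteq> all_edges V \<and> edge_iso S (star t)}"
    then obtain \<phi> where S: "S \<subseteq> all_edges V"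
      and bij: "bij_betw \<phi> (\<Union>S) {0..t}" and img: "(`) \<phi> ` S = star t"
      unfolding edge_iso_def Union_star by auto
    define \<psi> where "\<psi> = inv_into (\<Union>S) \<phi>"
    have bij': "bij_betw \<psi> {0..t} (\<Union>S)"
      unfolding \<psi>_def by (rule bij_betw_inv_into[OF bij])
    have "\<psi> ` (\<phi> ` e) = e" if "e \<in> S" for e
      unfolding \<psi>_def using that bij
      by (intro inv_into_image_cancel) (auto simp: bij_betw_def)
    then have "S = (`) \<psi> ` star t"
      unfolding img[symmetric] by (auto simp: image_image)
    then have "S = (\<lambda>l. {\<psi> 0, l}) ` (\<psi> ` {1..t})"
      unfolding star by (simp add: image_image)
    moreover have "\<psi> 0 \<in> \<Union>S" "\<psi> ` {1..t} \<subseteq> \<Union>S"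
      using bij' by (auto simp: bij_betw_def)
    moreover have "\<Union>S \<subseteq> V" using S by (auto simp: all_edges_def)
    moreover have inj: "inj_on \<psi> {0..t}" using bij' by (simp add: bij_betw_def)
    then have "\<psi> 0 \<notin> \<psi> ` {1..t}"
      by (subst inj_on_image_mem_iff[OF inj]) auto
    moreover have "card (\<psi> ` {1..t}) = t"
      using inj_on_subset[OF inj, of "{1..t}"] by (simp add: card_image)
    ultimately show "S \<in> (\<lambda>(c, L). (\<lambda>l. {c, l}) ` L) ` (SIGMA c:V. {L. L \<subseteq> V - {c} \<and> card L = t})"
      by (intro image_eqI[of _ _ "(\<psi> 0, \<psi> ` {1..t})"]) (simp, blast)
  next
    fix S assume "S \<in> (\<lambda>(c, L). (\<lambda>l. {c, l}) ` L) ` (SIGMA c:V. {L. L \<subseteq> V - {c} \<and> card L = t})"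
    then obtain c L where cL: "c \<in> V" "L \<subseteq> V - {c}" "card L = t" and S: "S = (\<lambda>l. {c, l}) ` L"
      by auto
    have "finite L" "L \<noteq> {}" using assms cL(3) by (auto intro: card_ge_0_finite)
    then obtain h where h: "bij_betw h L {1..t}"
      using cL(3) finite_same_card_bij[of L "{1..t}"] by auto
    define \<phi> where "\<phi> = h(c := 0)"
    have U: "\<Union>S = insert c L" using S \<open>L \<noteq> {}\<close> by auto
    have \<phi>c: "\<phi> c = 0" by (simp add: \<phi>_def)
    have \<phi>L: "\<phi> l = h l" if "l \<in> L" for l using that cL(2) by (auto simp: \<phi>_def)
    have "bij_betw \<phi> (insert c L) (insert 0 {1..t})"
      using notIn_Un_bij_betw[of c L \<phi> "{1..t}"] h cL(2) bij_betw_cong[of L \<phi> h, OF \<phi>L] \<phi>c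
      by auto
    moreover have "insert 0 {1..t} = {0..t}" by auto
    moreover have "(`) \<phi> ` S = star t"
    proof -
      have "(`) \<phi> ` S = (\<lambda>l. {0, h l}) ` L"
        unfolding S image_image using \<phi>L \<phi>c by (intro image_cong) auto
      also have "\<dots> = (\<lambda>i. {0, i}) ` (h ` L)" by (simp add: image_image)
      finally show ?thesis using h by (simp add: star bij_betw_def)
    qed
    ultimately have "edge_iso S (star t)"
      unfolding edge_iso_def U Union_star by auto
    moreover have "S \<subseteq> all_edges V"
      using S cL by (auto simp: all_edges_def card_insert_if)
    ultimately show "S \<in> {S. S \<subseteq> all_edges V \<and> edge_iso S (star t)}" by simp
  }
qed

lemma card_centre_leaves:
  assumes "finite V"
  shows "card (SIGMA c:V. {L. L \<subseteq> V - {c} \<and> card L = t}) = card V * ((card V - 1) choose t)"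
proof -
  have "card (SIGMA c:V. {L. L \<subseteq> V - {c} \<and> card L = t})
      = (\<Sum>c\<in>V. card {L. L \<subseteq> V - {c} \<and> card L = t})"
    using assms by (intro card_SigmaI) (auto intro: finite_subset[of _ "Pow V"])
  also have "\<dots> = (\<Sum>c\<in>V. (card V - 1) choose t)"
    using assms by (intro sum.cong) (auto simp: n_subsets)
  finally show ?thesis by simp
qed

lemma card_stars_le:
  assumes "finite V" "t \<ge> 1"
  shows "card {S. S \<subseteq> all_edges V \<and> edge_iso S (star t)} \<le> card V * ((card V - 1) choose t)"
proof -
  have "finite (SIGMA c:V. {L. L \<subseteq> V - {c} \<and> card L = t})"
    using assms(1) by (intro finite_SigmaI) (auto intro: finite_subset[of _ "Pow V"])
  then show ?thesis
    unfolding stars_eq_image[OF assms(2)] card_centre_leaves[OF assms(1), symmetric]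
    by (rule card_image_le)
qed

text \<open>A star has at most two possible centres, namely the endpoints of any one of its edges, and a centre
  determines the leaves.\<close>

lemma card_stars_ge:
  assumes "finite V" "t \<ge> 1"
  shows "card V * ((card V - 1) choose t) \<le> 2 * card {S. S \<subseteq> all_edges V \<and> edge_iso S (star t)}"
proof -
  define A where "A = (SIGMA c:V. {L. L \<subseteq> V - {c} \<and> card L = t})"
  define f where "f = (\<lambda>(c :: 'a, L). (\<lambda>l. {c, l}) ` L)"
  have fin: "finite A"
    unfolding A_def using assms(1)
    by (intro finite_SigmaI) (auto intro: finite_subset[of _ "Pow V"])
  have fibre: "card {p \<in> A. f p = S} \<le> 2" if "S \<in> f ` A" for S
  proof -
    have "S \<in> {S. S \<subseteq> all_edges V \<and> edge_iso S (star t)}"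
      using that unfolding stars_eq_image[OF assms(2)] A_def f_def .
    then have "S \<subseteq> all_edges V" "edge_iso S (star t)" by auto
    then have "S \<noteq> {}" using assms(2) by (auto simp: edge_iso_def star_def)
    with \<open>S \<subseteq> all_edges V\<close> obtain e where e: "e \<in> S" "card e = 2" by (auto simp: all_edges_def)
    have "snd p = \<Union>S - {fst p}" if "p \<in> {p \<in> A. f p = S}" for p
      using that by (auto simp: A_def f_def)
    then have "inj_on fst {p \<in> A. f p = S}"
      by (intro inj_onI) (metis prod_eqI)
    moreover have "fst ` {p \<in> A. f p = S} \<subseteq> e"
      using e unfolding f_def by auto
    moreover have "finite e" using e(2) by (simp add: card_ge_0_finite)
    ultimately show ?thesis using e(2) by (metis card_inj_on_le)
  qed
  have "card A = (\<Sum>S\<in>f ` A. card {p \<in> A. f p = S})"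
    using sum.image_gen[OF fin, of "\<lambda>_. 1::nat" f] by simp
  also have "\<dots> \<le> (\<Sum>S\<in>f ` A. 2)" by (intro sum_mono fibre)
  also have "\<dots> = 2 * card (f ` A)" by simp
  finally show ?thesis
    unfolding stars_eq_image[OF assms(2)] card_centre_leaves[OF assms(1), symmetric]
    by (simp add: A_def f_def)
qed

text \<open>Up to factorials, the left side is a product of factors \<open>(k - 1 - i)\<^sup>2\<close> and the right side one of
  factors \<open>k\<^sup>2 (n - 1 - i) / n\<close> over \<open>i < t\<close>. The factor \<open>fact t\<close> left over is what keeps stars
  uninformative for every \<open>t\<close>: the automorphisms of the star outweigh the gain \<open>(k\<^sup>2 / n) ^ t\<close>.\<close>

lemma binomial_square_le:
  assumes "1 \<le> k" "k \<le> n"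
  shows "fact t * (real ((k - 1) choose t))\<^sup>2 \<le> ((real k)\<^sup>2 / real n) ^ t * real ((n - 1) choose t)"
proof (induction t)
  case 0
  show ?case by simp
next
  case (Suc t)
  have step: "real (Suc t) * real (m choose Suc t) = real (m - t) * real (m choose t)" for m
  proof -
    have "Suc t * (m choose Suc t) = (m - t) * (m choose t)"
      by (simp only: binomial_absorption binomial_absorb_comp)
    then show ?thesis by (metis of_nat_mult)
  qed
  have factor: "(real (k - 1 - t))\<^sup>2 \<le> (real k)\<^sup>2 / real n * real (n - 1 - t)"
  proof (cases "t + 1 \<le> k")
    case True
    have "real n * (real k - 1 - real t) \<le> real k * (real n - 1 - real t)"
    proof -
      have "real k * (1 + real t) \<le> real n * (1 + real t)"
        using assms by (intro mult_right_mono) auto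
      then show ?thesis by (simp add: algebra_simps)
    qed
    then have "real k * (real n * (real k - 1 - real t)) \<le> real k * (real k * (real n - 1 - real t))"
      by (intro mult_left_mono) auto
    moreover have "real n * ((real k - 1 - real t) * (real k - 1 - real t))
        \<le> real n * (real k * (real k - 1 - real t))"
      using True by (intro mult_left_mono mult_right_mono) auto
    ultimately have "real n * (real k - 1 - real t)\<^sup>2 \<le> (real k)\<^sup>2 * (real n - 1 - real t)"
      by (simp add: power2_eq_square algebra_simps)
    then show ?thesis
      using True assms by (simp add: field_simps of_nat_diff)
  qed simp
  have "fact (Suc t) * (real ((k - 1) choose Suc t))\<^sup>2 * real (Suc t)
      = fact t * (real (Suc t) * real ((k - 1) choose Suc t))\<^sup>2"
    by (simp add: power2_eq_square)
  also have "\<dots> = (real (k - 1 - t))\<^sup>2 * (fact t * (real ((k - 1) choose t))\<^sup>2)"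
    unfolding step by (simp add: power_mult_distrib)
  also have "\<dots> \<le> ((real k)\<^sup>2 / real n * real (n - 1 - t))
      * (((real k)\<^sup>2 / real n) ^ t * real ((n - 1) choose t))"
    by (intro mult_mono factor Suc.IH) auto
  also have "\<dots> = ((real k)\<^sup>2 / real n) ^ Suc t * (real (n - 1 - t) * real ((n - 1) choose t))"
    by simp
  also have "\<dots> = ((real k)\<^sup>2 / real n) ^ Suc t * real ((n - 1) choose Suc t) * real (Suc t)"
    unfolding step[symmetric] by simp
  finally show ?case by (rule mult_right_le_imp_le) simp
qed

lemma power_le_fact_exp: "0 \<le> x \<Longrightarrow> x ^ t \<le> fact t * exp (x :: real)"
proof -
  assume "0 \<le> x"
  then have "(\<Sum>i\<in>{t}. inverse (fact i) *\<^sub>R x ^ i) \<le> exp x"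
    unfolding exp_def by (intro sum_le_suminf summable_exp_generic) auto
  then show ?thesis by (simp add: field_simps)
qed

text \<open>Signal against noise for stars: the left side is the squared mean under a planted clique, the
  cardinality on the right is the null variance. The bound is uniform in \<open>t\<close> because
  \<open>D ^ t / fact t \<le> exp D\<close>.\<close>

lemma card_stars_square_le:
  assumes "W \<subseteq> {1..n}" "card W = k" "1 \<le> k" "t \<ge> 1" "(real k)\<^sup>2 / real n \<le> D"
  shows "(real (card {S. S \<subseteq> all_edges W \<and> edge_iso S (star t)}))\<^sup>2
    \<le> 2 * D * exp D * real (card {S. S \<subseteq> all_edges {1..n} \<and> edge_iso S (star t)})"
    (is "(real ?M)\<^sup>2 \<le> _ * real ?N")
proof -
  have fin: "finite W" using assms(1) finite_subset by blast
  have kn: "k \<le> n" using card_mono[OF _ assms(1)] assms(2) by simp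
  define r where "r = (real k)\<^sup>2 / real n"
  define a where "a = real ((k - 1) choose t)"
  define b where "b = real ((n - 1) choose t)"
  have r: "0 \<le> r" "r \<le> D" "real n * r = (real k)\<^sup>2"
    using assms(3,5) kn by (auto simp: r_def)
  have "fact t * a\<^sup>2 \<le> r ^ t * b"
    unfolding a_def b_def r_def using binomial_square_le[OF assms(3) kn] .
  also have "\<dots> \<le> fact t * exp r * b"
    using power_le_fact_exp[OF r(1)] by (intro mult_right_mono) (auto simp: b_def)
  finally have ab: "a\<^sup>2 \<le> exp r * b" by simp
  have M: "real ?M \<le> real k * a"
    unfolding a_def using card_stars_le[OF fin assms(4)] assms(2) by (metis of_nat_le_iff of_nat_mult)
  have N: "real n * b \<le> 2 * real ?N"
    unfolding b_def using card_stars_ge[of "{1..n}" t] assms(4)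
    by (metis card_atLeastAtMost diff_Suc_1 finite_atLeastAtMost of_nat_le_iff of_nat_mult of_nat_numeral)
  have "(real ?M)\<^sup>2 \<le> (real k * a)\<^sup>2" using M by (intro power_mono) auto
  also have "\<dots> = real n * r * a\<^sup>2" by (simp add: power_mult_distrib r)
  also have "\<dots> \<le> real n * r * (exp r * b)" using ab r by (intro mult_left_mono) auto
  also have "\<dots> = r * exp r * (real n * b)" by simp
  also have "\<dots> \<le> D * exp D * (2 * real ?N)"
  proof (rule mult_mono[OF _ N])
    show "r * exp r \<le> D * exp D" using r by (intro mult_mono) auto
    show "0 \<le> D * exp D" "0 \<le> real n * b" using r by (auto simp: b_def)
  qed
  finally show ?thesis by simp
qed

lemma star_nonempty: "t \<ge> 1 \<Longrightarrow> edge_iso S (star t) \<Longrightarrow> S \<noteq> {}"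
  by (auto simp: edge_iso_def star_def)

text \<open>The ratio that strong separation sends to 0 is at least the null standard deviation divided by the
  shift of the mean; this inequality keeps that quotient away from 0.\<close>

lemma star_count_square_shift_le_variance:
  assumes "1 \<le> k" "k \<le> n" "t \<ge> 1" "(real k)\<^sup>2 / real n \<le> D"
  shows "(measure_pmf.expectation (planted_clique n (1/2) k) (signed_count n (1/2) (star t))
          - measure_pmf.expectation (gnp n (1/2)) (signed_count n (1/2) (star t)))\<^sup>2
    \<le> 2 * D * exp D * measure_pmf.variance (gnp n (1/2)) (signed_count n (1/2) (star t))"
proof -
  let ?f = "signed_count n (1/2) (star t)"
  define X where "X = {S. S \<subseteq> all_edges {1..n} \<and> edge_iso S (star t)}"
  have f: "?f = (\<lambda>G. \<Sum>S\<in>X. chi (1/2) S G)"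
    by (simp add: fun_eq_iff signed_count_def X_def)
  have X: "finite X"
    unfolding X_def by (rule finite_subset[of _ "Pow (all_edges {1..n})"]) (auto simp: finite_all_edges)
  have sub: "\<And>S. S \<in> X \<Longrightarrow> S \<subseteq> all_edges {1..n}" by (simp add: X_def)
  have ne: "\<And>S. S \<in> X \<Longrightarrow> S \<noteq> {}" using star_nonempty[OF assms(3)] unfolding X_def by blast
  have "card {(S, T) \<in> X \<times> X. S = T} = card ((\<lambda>S. (S, S)) ` X)"
    by (intro arg_cong[where f = card]) auto
  also have "\<dots> = card X" by (intro card_image) (auto simp: inj_on_def)
  finally have Q: "measure_pmf.expectation (gnp n (1/2)) ?f = 0"
      "measure_pmf.variance (gnp n (1/2)) ?f = real (card X)"
    unfolding f using variance_sum_chi_gnp[where X = X and S = "\<lambda>S. S", OF X sub ne] by auto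
  define \<beta> where "\<beta> = sqrt (2 * D * exp D * real (card X))"
  have D: "0 \<le> D" using assms(4) by (rule order_trans[rotated]) auto
  have E: "measure_pmf.expectation (gnp n (1/2)) (\<lambda>G. ?f (\<lambda>e. G e \<or> e \<in> all_edges W)) \<in> {0..\<beta>}"
    if W: "W \<subseteq> {1..n}" "card W = k" for W
  proof -
    have "{S \<in> X. S \<subseteq> all_edges W} = {S. S \<subseteq> all_edges W \<and> edge_iso S (star t)}"
      using all_edges_mono[OF W(1)] by (auto simp: X_def)
    then have "(real (card {S \<in> X. S \<subseteq> all_edges W}))\<^sup>2 \<le> 2 * D * exp D * real (card X)"
      using card_stars_square_le[OF W assms(1,3,4)] by (simp add: X_def)
    then have "real (card {S \<in> X. S \<subseteq> all_edges W}) \<le> \<beta>"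
      unfolding \<beta>_def by (rule real_le_rsqrt)
    then show ?thesis
      unfolding f by (subst expectation_sum_chi_planted[OF X sub]) auto
  qed
  have "measure_pmf.expectation (planted_clique n (1/2) k) ?f \<le> \<beta>"
    using E by (intro expectation_planted_clique_le[OF assms(2)]) auto
  moreover have "measure_pmf.expectation (planted_clique n (1/2) k) (\<lambda>G. - ?f G) \<le> 0"
    using E by (intro expectation_planted_clique_le[OF assms(2)]) auto
  ultimately have "(measure_pmf.expectation (planted_clique n (1/2) k) ?f)\<^sup>2 \<le> \<beta>\<^sup>2"
    by (intro power_mono) auto
  also have "\<beta>\<^sup>2 = 2 * D * exp D * real (card X)"
    using D by (simp add: \<beta>_def)
  finally show ?thesis using Q by simp
qed

lemma star_count_not_strongly_separates:
  assumes "C > 0" and k: "clique_size C k" and t: "\<And>n. t n \<ge> 1"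
  shows "\<not> strongly_separates (\<lambda>n. planted_clique n (1/2) (k n)) (\<lambda>n. gnp n (1/2))
             (\<lambda>n. signed_count n (1/2) (star (t n)))"
proof
  define a where "a = (\<lambda>n. max (sqrt (measure_pmf.variance (planted_clique n (1/2) (k n))
      (signed_count n (1/2) (star (t n))))) (sqrt (measure_pmf.variance (gnp n (1/2))
      (signed_count n (1/2) (star (t n))))))"
  define b where "b = (\<lambda>n. \<bar>measure_pmf.expectation (planted_clique n (1/2) (k n))
      (signed_count n (1/2) (star (t n))) - measure_pmf.expectation (gnp n (1/2))
      (signed_count n (1/2) (star (t n)))\<bar>)"
  assume "strongly_separates (\<lambda>n. planted_clique n (1/2) (k n)) (\<lambda>n. gnp n (1/2))
             (\<lambda>n. signed_count n (1/2) (star (t n)))"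
  then have nz: "\<forall>\<^sub>F n in sequentially. b n \<noteq> 0" and lim: "(\<lambda>n. a n / b n) \<longlonglongrightarrow> 0"
    unfolding strongly_separates_def Let_def a_def b_def by auto
  \<comment> \<open>bounds \<open>k\<^sup>2 / n\<close>; the summand 1 absorbs the rounding of \<open>C * sqrt n\<close>\<close>
  define D where "D = (C + 1)\<^sup>2"
  \<comment> \<open>eventually a lower bound for the ratio of noise to signal\<close>
  define c where "c = 1 / sqrt (2 * D * exp D)"
  have D: "D > 0" using assms(1) by (simp add: D_def)
  then have c: "c > 0" by (simp add: c_def)
  have size: "\<bar>real (k n) - C * sqrt (real n)\<bar> < 1" for n
    using k by (simp add: clique_size_def)
  have "\<forall>\<^sub>F n in sequentially. C * sqrt (real n) \<ge> 1" "\<forall>\<^sub>F n in sequentially. C * sqrt (real n) + 1 \<le> real n"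
    using assms(1) by real_asymp+
  then have "\<forall>\<^sub>F n in sequentially. c \<le> a n / b n"
    using nz eventually_gt_at_top[of 0]
  proof eventually_elim
    case (elim n)
    have kn: "1 \<le> k n" "k n \<le> n" using size[of n] elim by linarith+
    have "real (k n) \<le> (C + 1) * sqrt (real n)"
      using size[of n] elim(4) by (simp add: algebra_simps) (smt (verit) real_sqrt_ge_1_iff of_nat_1 of_nat_le_iff Suc_leI One_nat_def)
    then have "(real (k n))\<^sup>2 \<le> ((C + 1) * sqrt (real n))\<^sup>2" by (intro power_mono) auto
    then have "(real (k n))\<^sup>2 / real n \<le> D"
      using elim(4) unfolding power_mult_distrib by (simp add: D_def divide_le_eq)
    from star_count_square_shift_le_variance[OF kn t[of n] this]
    have "(b n)\<^sup>2 \<le> 2 * D * exp D * measure_pmf.variance (gnp n (1/2)) (signed_count n (1/2) (star (t n)))"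
      by (simp add: b_def)
    then have "b n \<le> sqrt (2 * D * exp D * measure_pmf.variance (gnp n (1/2)) (signed_count n (1/2) (star (t n))))"
      by (rule real_le_rsqrt)
    also have "\<dots> \<le> sqrt (2 * D * exp D) * a n"
      unfolding real_sqrt_mult[of "2 * D * exp D"] a_def using D by (intro mult_left_mono) auto
    finally have "c * b n \<le> a n" using D by (simp add: c_def field_simps)
    moreover have "b n > 0" using elim(3) by (simp add: b_def)
    ultimately show ?case by (simp add: field_simps)
  qed
  then have "c \<le> 0" by (rule tendsto_lowerbound[OF lim]) simp
  with c show False by simp
qed

section \<open>Labelled paths\<close>

text \<open>A labelled path on \<open>v\<close> vertices is an injective map from \<open>{..<v}\<close>. Every unlabelled path arises
  from its two traversals, so \<open>path_count\<close> below is twice the signed count of paths.\<close>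

definition path_edges :: "nat \<Rightarrow> (nat \<Rightarrow> 'a) \<Rightarrow> 'a set set" where
  "path_edges v x = (\<lambda>i. {x i, x (Suc i)}) ` {i. Suc i < v}"

definition embeddings :: "nat \<Rightarrow> 'a set \<Rightarrow> (nat \<Rightarrow> 'a) set" where
  "embeddings v V = {x \<in> {..<v} \<rightarrow>\<^sub>E V. inj_on x {..<v}}"

definition path_count :: "nat \<Rightarrow> nat \<Rightarrow> (nat set \<Rightarrow> bool) \<Rightarrow> real" where
  "path_count v n G = (\<Sum>x\<in>embeddings v {1..n}. chi (1/2) (path_edges v x) G)"

lemma finite_embeddings: "finite V \<Longrightarrow> finite (embeddings v V)"
  unfolding embeddings_def
  by (rule finite_subset[of _ "{..<v} \<rightarrow>\<^sub>E V"]) (auto intro!: finite_PiE)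

lemma Union_path_edges:
  assumes "v \<ge> 2"
  shows "\<Union>(path_edges v x) = x ` {..<v}"
proof (intro equalityI subsetI)
  fix u assume "u \<in> x ` {..<v}"
  then obtain i where i: "i < v" "u = x i" by auto
  show "u \<in> \<Union>(path_edges v x)"
  proof (cases i)
    case 0
    then have "{x 0, x (Suc 0)} \<in> path_edges v x" using assms by (auto simp: path_edges_def)
    then show ?thesis using i 0 by auto
  next
    case (Suc j)
    then have "{x j, x (Suc j)} \<in> path_edges v x" using i by (auto simp: path_edges_def)
    then show ?thesis using i Suc by auto
  qed
qed (auto simp: path_edges_def)

lemma path_edges_nonempty: "v \<ge> 2 \<Longrightarrow> path_edges v x \<noteq> {}"
  by (auto simp: path_edges_def intro!: exI[of _ 0])

lemma path_edges_subset:
  assumes "x \<in> embeddings v V"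
  shows "path_edges v x \<subseteq> all_edges V"
proof
  fix e assume "e \<in> path_edges v x"
  then obtain i where i: "Suc i < v" "e = {x i, x (Suc i)}" by (auto simp: path_edges_def)
  moreover from i have "x i \<noteq> x (Suc i)"
    using assms inj_onD[of x "{..<v}" i "Suc i"] by (auto simp: embeddings_def)
  moreover from i have "x i \<in> V" "x (Suc i) \<in> V"
    using assms PiE_mem[of x "{..<v}" "\<lambda>_. V"] by (simp_all add: embeddings_def)
  ultimately show "e \<in> all_edges V" by (auto simp: all_edges_def)
qed

lemma card_embeddings:
  assumes "finite V"
  shows "card (embeddings v V) = (\<Prod>i\<in>{0..<v}. card V - i)"
  unfolding embeddings_def using card_inj_on_subset_funcset[of "{..<v}" V "{..<v}"] assms
  by simp

lemma card_embeddings_ge: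
  assumes "finite V"
  shows "(card V - v) ^ v \<le> card (embeddings v V)"
proof -
  have "(\<Prod>i\<in>{0..<v}. card V - v) \<le> (\<Prod>i\<in>{0..<v}. card V - i)"
    by (intro prod_mono) auto
  then show ?thesis unfolding card_embeddings[OF assms] by simp
qed

text \<open>A path can be traversed from a given endpoint in only one way: once \<open>x\<close> and \<open>y\<close> agree up to
  position \<open>m\<close>, the edge that leaves position \<open>m\<close> in \<open>y\<close> is an edge of \<open>x\<close> at \<open>x m\<close>, and it cannot be
  the one leading back.\<close>

lemma path_determined_by_start:
  assumes "x \<in> embeddings v V" "y \<in> embeddings v V"
    and "path_edges v x = path_edges v y" "x 0 = y 0"
  shows "x = y"
proof -
  have inj: "inj_on x {..<v}" "inj_on y {..<v}"
    using assms(1,2) by (auto simp: embeddings_def)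
  have "i < v \<Longrightarrow> x i = y i" for i
  proof (induction i rule: less_induct)
    case (less i)
    show ?case
    proof (cases i)
      case (Suc m)
      have m: "x m = y m" using less Suc by simp
      have "{y m, y i} \<in> path_edges v y" using less.prems Suc by (auto simp: path_edges_def)
      then have "{y m, y i} \<in> path_edges v x" using assms(3) by simp
      then obtain j where j: "Suc j < v" "{y m, y i} = {x j, x (Suc j)}"
        unfolding path_edges_def by blast
      have "x m = x j \<and> y i = x (Suc j) \<or> x m = x (Suc j) \<and> y i = x j"
        using j(2) m by (auto simp: doubleton_eq_iff)
      then show ?thesis
      proof
        assume A: "x m = x j \<and> y i = x (Suc j)"
        then have "m = j" using inj(1) j(1) less.prems Suc by (auto simp: inj_on_def)
        then show ?thesis using A Suc by simp
      next
        assume A: "x m = x (Suc j) \<and> y i = x j"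
        then have "m = Suc j" using inj(1) j(1) less.prems Suc by (auto simp: inj_on_def)
        then have "x j = y j" using less Suc by simp
        then have "y i = y j" using A by simp
        then have "i = j" using inj(2) j(1) less.prems by (auto simp: inj_on_def)
        then show ?thesis using \<open>m = Suc j\<close> Suc by simp
      qed
    qed (use assms(4) in simp)
  qed
  then show ?thesis
    using assms(1,2) unfolding embeddings_def by (intro PiE_ext[of x "{..<v}" "\<lambda>_. V"]) auto
qed

text \<open>For \<open>V = {1..n}\<close> this bounds the null variance. The factor \<open>v\<close> bounds the number of starting
  vertices that a path with the edges of \<open>x\<close> can have; the true factor is 2, but any factor
  subexponential in \<open>v\<close> serves.\<close>

lemma card_same_path_le:
  assumes "finite V" "v \<ge> 2"
  shows "card {(x, y) \<in> embeddings v V \<times> embeddings v V. path_edges v x = path_edges v y}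
    \<le> v * card V ^ v"
proof -
  let ?X = "embeddings v V"
  have "{(x, y) \<in> ?X \<times> ?X. path_edges v x = path_edges v y}
      = (SIGMA x:?X. {y \<in> ?X. path_edges v x = path_edges v y})" by auto
  then have "card {(x, y) \<in> ?X \<times> ?X. path_edges v x = path_edges v y}
      = (\<Sum>x\<in>?X. card {y \<in> ?X. path_edges v x = path_edges v y})"
    using finite_embeddings[OF assms(1), of v] by (simp only:) (intro card_SigmaI, auto)
  also have "\<dots> \<le> (\<Sum>x\<in>?X. v)"
  proof (intro sum_mono)
    fix x assume x: "x \<in> ?X"
    have "card {y \<in> ?X. path_edges v x = path_edges v y} \<le> card (x ` {..<v})"
    proof (rule card_inj_on_le[where f = "\<lambda>y. y 0"])
      show "inj_on (\<lambda>y. y 0) {y \<in> ?X. path_edges v x = path_edges v y}"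
        by (intro inj_onI) (auto intro: path_determined_by_start)
      show "(\<lambda>y. y 0) ` {y \<in> ?X. path_edges v x = path_edges v y} \<subseteq> x ` {..<v}"
      proof (intro subsetI, elim imageE, clarify)
        fix y assume "path_edges v x = path_edges v y"
        then have "x ` {..<v} = y ` {..<v}" by (metis Union_path_edges assms(2))
        then show "y 0 \<in> x ` {..<v}" using assms(2) by auto
      qed
    qed auto
    also have "\<dots> \<le> v" using card_image_le[of "{..<v}" x] by simp
    finally show "card {y \<in> ?X. path_edges v x = path_edges v y} \<le> v" .
  qed
  also have "\<dots> = v * card ?X" by simp
  also have "card ?X \<le> card ({..<v} \<rightarrow>\<^sub>E V)"
    unfolding embeddings_def using assms(1) by (intro card_mono) (auto intro: finite_PiE)
  also have "card ({..<v} \<rightarrow>\<^sub>E V) = card V ^ v" by (simp add: card_PiE)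
  finally show ?thesis by simp
qed

lemma path_crosses_boundary:
  assumes "i < v" "j < v" "x i \<in> W" "x j \<notin> W"
  shows "\<exists>m. Suc m < v \<and> (x m \<in> W \<longleftrightarrow> x (Suc m) \<notin> W)"
proof (rule ccontr)
  assume "\<not> ?thesis"
  then have same: "Suc m < v \<Longrightarrow> x m \<in> W \<longleftrightarrow> x (Suc m) \<in> W" for m by blast
  have "m < v \<Longrightarrow> x m \<in> W \<longleftrightarrow> x 0 \<in> W" for m
    by (induction m) (use same in auto)
  then show False using assms by blast
qed

lemma card_PiE_two_values:
  assumes "I \<subseteq> {..<v}"
  shows "card (\<Pi>\<^sub>E i\<in>{..<v}. if i \<in> I then A else B) = card A ^ card I * card B ^ (v - card I)"
proof -
  have "card (\<Pi>\<^sub>E i\<in>{..<v}. if i \<in> I then A else B) = (\<Prod>i\<in>{..<v}. if i \<in> I then card A else card B)"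
    by (simp add: card_PiE if_distrib)
  also have "\<dots> = (\<Prod>i\<in>I. card A) * (\<Prod>i\<in>{..<v} - I. card B)"
    using assms by (subst prod.If_cases) (auto simp: Int_absorb1 Diff_eq)
  finally show ?thesis
    using assms by (simp add: card_Diff_subset finite_subset)
qed

text \<open>The decisive gain for paths that meet the clique and leave it. Two paths with the same random part
  share all their vertices outside \<open>W\<close>. A path that has vertices on both sides of \<open>W\<close> also crosses
  the boundary along an edge, which is shared and brings one more common vertex, inside \<open>W\<close>. So
  \<open>y\<close> has at most \<open>v - 1 - a\<close> vertices of its own, where \<open>a\<close> is the number of vertices of \<open>x\<close>
  outside \<open>W\<close>, and all of them lie in \<open>W\<close>.\<close>

lemma overlapping_paths_outside:
  assumes xy: "x \<in> embeddings v V" "y \<in> embeddings v V" "v \<ge> 2"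
    and same: "path_edges v x - all_edges W = path_edges v y - all_edges W"
    and meets: "x ` {..<v} \<inter> W \<noteq> {}" and leaves: "\<not> path_edges v x \<subseteq> all_edges W"
  shows "card {i. i < v \<and> x i \<notin> W} + card {i. i < v \<and> y i \<notin> x ` {..<v}} \<le> v - 1"
    and "\<And>i. i < v \<Longrightarrow> y i \<in> x ` {..<v} \<or> y i \<in> W"
proof -
  have inj: "inj_on x {..<v}" "inj_on y {..<v}"
    using xy by (auto simp: embeddings_def)
  have outside: "u \<in> z' ` {..<v}"
    if "u \<in> z ` {..<v}" "u \<notin> W" and "path_edges v z - all_edges W = path_edges v z' - all_edges W"
    for u and z z' :: "nat \<Rightarrow> 'a"
  proof -
    have "u \<in> \<Union>(path_edges v z)"
      using that(1) by (simp only: Union_path_edges[OF xy(3)])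
    then obtain e where "e \<in> path_edges v z" "u \<in> e" by (rule UnionE)
    with that(2) have "e \<in> path_edges v z - all_edges W" by (auto simp: all_edges_def)
    with that(3) have "e \<in> path_edges v z'" by blast
    with \<open>u \<in> e\<close> have "u \<in> \<Union>(path_edges v z')" by (rule UnionI[rotated])
    then show ?thesis by (simp only: Union_path_edges[OF xy(3)])
  qed
  show "y i \<in> x ` {..<v} \<or> y i \<in> W" if "i < v" for i
    using outside[of "y i" y x] that same by (metis imageI lessThan_iff)
  have "\<exists>j<v. x j \<notin> W"
  proof (rule ccontr)
    assume "\<not> ?thesis"
    then have "x \<in> embeddings v W" using xy(1) by (auto simp: embeddings_def PiE_def)
    then show False using path_edges_subset[of x v W] leaves by blast
  qed
  then obtain m where m: "Suc m < v" "x m \<in> W \<longleftrightarrow> x (Suc m) \<notin> W"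
    using path_crosses_boundary[where x = x and W = W and v = v] meets by auto
  have "{x m, x (Suc m)} \<in> path_edges v x - all_edges W"
    using m by (auto simp: path_edges_def all_edges_def)
  then have "{x m, x (Suc m)} \<in> path_edges v y" using same by auto
  then have mem: "{x m, x (Suc m)} \<subseteq> y ` {..<v}"
    unfolding Union_path_edges[OF xy(3), symmetric] by (rule Union_upper)
  define U where "U = x ` {..<v} - W"
  \<comment> \<open>the inner endpoint of the crossing edge: the common vertex inside \<open>W\<close>\<close>
  define w where "w = (if x m \<in> W then x m else x (Suc m))"
  have w: "w \<in> W" "w \<in> x ` {..<v}" "w \<in> y ` {..<v}"
    using m mem by (auto simp: w_def)
  have "card {i. i < v \<and> x i \<notin> W} = card (x ` {i. i < v \<and> x i \<notin> W})"
    using inj(1) by (intro card_image[symmetric] inj_on_subset[OF inj(1)]) auto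
  also have "x ` {i. i < v \<and> x i \<notin> W} = U" by (auto simp: U_def)
  finally have cI: "card {i. i < v \<and> x i \<notin> W} = card U" .
  have "card {i. i < v \<and> y i \<notin> x ` {..<v}} = card (y ` {i. i < v \<and> y i \<notin> x ` {..<v}})"
    by (intro card_image[symmetric] inj_on_subset[OF inj(2)]) auto
  also have "y ` {i. i < v \<and> y i \<notin> x ` {..<v}} = y ` {..<v} - x ` {..<v}" by auto
  finally have cJ: "card {i. i < v \<and> y i \<notin> x ` {..<v}} = card (y ` {..<v} - x ` {..<v})" .
  have "U \<subseteq> y ` {..<v}" using outside[of _ x y] same by (auto simp: U_def)
  then have "insert w U \<union> (y ` {..<v} - x ` {..<v}) \<subseteq> y ` {..<v}" using w by auto
  then have "card (insert w U \<union> (y ` {..<v} - x ` {..<v})) \<le> card (y ` {..<v})"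
    by (intro card_mono) auto
  moreover have "card (insert w U \<union> (y ` {..<v} - x ` {..<v}))
      = card (insert w U) + card (y ` {..<v} - x ` {..<v})"
    using w by (intro card_Un_disjoint) (auto simp: U_def)
  moreover have "card (insert w U) = Suc (card U)"
    using w by (intro card_insert_disjoint) (auto simp: U_def)
  moreover have "card (y ` {..<v}) = v" using inj(2) by (simp add: card_image)
  ultimately show "card {i. i < v \<and> x i \<notin> W} + card {i. i < v \<and> y i \<notin> x ` {..<v}} \<le> v - 1"
    using cI cJ by linarith
qed

text \<open>Pairs are grouped by the positions \<open>I\<close> at which \<open>x\<close> is outside \<open>W\<close> and the positions \<open>J\<close> at which
  \<open>y\<close> avoids \<open>x\<close>. With \<open>k = card W\<close>, a group has at most
  \<open>n ^ card I * k ^ (v - card I) * k ^ card J * v ^ v\<close> pairs; as \<open>n \<le> k\<^sup>2\<close>, the exponent of \<open>k\<close>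
  amounts to \<open>v + card I + card J\<close>, which is at most \<open>2 * v - 1\<close>. Up to factors that
  depend on \<open>v\<close> only, this is \<open>k\<close> times smaller than the squared mean.\<close>

lemma card_overlapping_paths_le:
  assumes V: "finite V" "card V \<le> (card W)\<^sup>2" and W: "W \<subseteq> V" "W \<noteq> {}" and v: "v \<ge> 2"
  shows "card {(x, y) \<in> embeddings v V \<times> embeddings v V.
      path_edges v x - all_edges W = path_edges v y - all_edges W \<and> \<not> path_edges v x \<subseteq> all_edges W
      \<and> x ` {..<v} \<inter> W \<noteq> {}}
    \<le> (4 * v) ^ v * card W ^ (2 * v - 1)"
proof -
  define k where "k = card W"
  have k: "k \<ge> 1" using W V finite_subset[of W V] by (metis One_nat_def Suc_leI V(1) card_gt_0_iff k_def)
  have finW: "finite W" by (rule finite_subset[OF W(1) V(1)])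
  define A where "A = (\<lambda>I. \<Pi>\<^sub>E i\<in>{..<v}. if i \<in> I then V else W)"
  define B where "B = (\<lambda>J x. \<Pi>\<^sub>E i\<in>{..<v}. if i \<in> J then W else x ` {..<v})"
  define \<I> where "\<I> = {(I, J). I \<subseteq> {..<v} \<and> J \<subseteq> {..<v} \<and> card I + card J \<le> v - 1}"
  have fin: "finite (A I)" "finite (B J x)" for I J x
    unfolding A_def B_def using V finW by (auto intro!: finite_PiE)
  have fin\<I>: "finite \<I>" "card \<I> \<le> 4 ^ v"
  proof -
    have sub: "\<I> \<subseteq> Pow {..<v} \<times> Pow {..<v}" by (auto simp: \<I>_def)
    then show "finite \<I>" by (rule finite_subset) simp
    have "card \<I> \<le> card (Pow {..<v} \<times> Pow {..<v})" by (intro card_mono sub) simp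
    also have "\<dots> = 4 ^ v" by (simp add: card_cartesian_product card_Pow flip: power_mult_distrib)
    finally show "card \<I> \<le> 4 ^ v" .
  qed
  have "{(x, y) \<in> embeddings v V \<times> embeddings v V.
      path_edges v x - all_edges W = path_edges v y - all_edges W \<and> \<not> path_edges v x \<subseteq> all_edges W
      \<and> x ` {..<v} \<inter> W \<noteq> {}} \<subseteq> (\<Union>(I, J)\<in>\<I>. SIGMA x:A I. B J x)" (is "?P \<subseteq> ?U")
  proof
    fix z assume "z \<in> ?P"
    then obtain x y where z: "z = (x, y)" and x: "x \<in> embeddings v V" and y: "y \<in> embeddings v V"
      and same: "path_edges v x - all_edges W = path_edges v y - all_edges W"
      and leaves: "\<not> path_edges v x \<subseteq> all_edges W" and meets: "x ` {..<v} \<inter> W \<noteq> {}"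
      by blast
    note out = overlapping_paths_outside[OF x y v same meets leaves]
    let ?I = "{i. i < v \<and> x i \<notin> W}" and ?J = "{i. i < v \<and> y i \<notin> x ` {..<v}}"
    have "(?I, ?J) \<in> \<I>" using out(1) by (auto simp: \<I>_def)
    moreover have "x \<in> A ?I" using x by (auto simp: A_def embeddings_def PiE_iff)
    moreover have "y \<in> B ?J x" using y out(2) by (auto simp: B_def embeddings_def PiE_iff)
    ultimately show "z \<in> ?U" unfolding z by blast
  qed
  then have "card ?P \<le> card ?U"
    by (rule card_mono[rotated]) (use fin fin\<I> in auto)
  also have "\<dots> \<le> (\<Sum>(I, J)\<in>\<I>. card (SIGMA x:A I. B J x))"
    using card_UN_le[OF fin\<I>(1), of "\<lambda>(I, J). SIGMA x:A I. B J x"] by (simp add: case_prod_unfold)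
  also have "\<dots> \<le> (\<Sum>(I, J)\<in>\<I>. v ^ v * k ^ (2 * v - 1))"
  proof (intro sum_mono, clarify)
    fix I J assume "(I, J) \<in> \<I>"
    then have IJ: "I \<subseteq> {..<v}" "J \<subseteq> {..<v}" "card I + card J \<le> v - 1" by (auto simp: \<I>_def)
    have "card (SIGMA x:A I. B J x) = (\<Sum>x\<in>A I. card (B J x))"
      using fin by (intro card_SigmaI) auto
    also have "\<dots> \<le> (\<Sum>x\<in>A I. k ^ card J * v ^ v)"
    proof (intro sum_mono)
      fix x
      have "card (B J x) = k ^ card J * card (x ` {..<v}) ^ (v - card J)"
        unfolding B_def k_def by (rule card_PiE_two_values[OF IJ(2)])
      also have "card (x ` {..<v}) ^ (v - card J) \<le> v ^ (v - card J)"
        using card_image_le[of "{..<v}" x] by (intro power_mono) auto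
      also have "v ^ (v - card J) \<le> v ^ v" using v by (intro power_increasing) auto
      finally show "card (B J x) \<le> k ^ card J * v ^ v" by simp
    qed
    also have "\<dots> = card V ^ card I * k ^ (v - card I) * (k ^ card J * v ^ v)"
      using card_PiE_two_values[OF IJ(1), of V W] by (simp add: A_def k_def)
    also have "card V ^ card I \<le> (k\<^sup>2) ^ card I"
      using V(2) by (intro power_mono) (auto simp: k_def)
    also have "(k\<^sup>2) ^ card I * k ^ (v - card I) * (k ^ card J * v ^ v)
        = v ^ v * k ^ (2 * card I + (v - card I) + card J)"
      by (simp add: power_add flip: power_mult)
    also have "k ^ (2 * card I + (v - card I) + card J) \<le> k ^ (2 * v - 1)"
      using IJ(3) k by (intro power_increasing) auto
    finally show "card (SIGMA x:A I. B J x) \<le> v ^ v * k ^ (2 * v - 1)" by simp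
  qed
  also have "\<dots> = card \<I> * (v ^ v * k ^ (2 * v - 1))" by simp
  also have "\<dots> \<le> 4 ^ v * (v ^ v * k ^ (2 * v - 1))" using fin\<I>(2) by (intro mult_right_mono) auto
  finally show ?thesis by (simp add: k_def power_mult_distrib mult.assoc)
qed

text \<open>A path that avoids the clique consists of random edges only, so a path with the same random part has
  the same edges altogether; all other pairs are of the overlapping kind.\<close>

lemma card_path_pairs_le:
  assumes V: "finite V" "card V \<le> (card W)\<^sup>2" and W: "W \<subseteq> V" "W \<noteq> {}" and v: "v \<ge> 2"
  shows "card {(x, y) \<in> embeddings v V \<times> embeddings v V.
      path_edges v x - all_edges W = path_edges v y - all_edges W \<and> \<not> path_edges v x \<subseteq> all_edges W}
    \<le> v * card V ^ v + (4 * v) ^ v * card W ^ (2 * v - 1)"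
proof -
  let ?X = "embeddings v V"
  let ?same = "{(x, y) \<in> ?X \<times> ?X. path_edges v x = path_edges v y}"
  let ?over = "{(x, y) \<in> ?X \<times> ?X.
      path_edges v x - all_edges W = path_edges v y - all_edges W \<and> \<not> path_edges v x \<subseteq> all_edges W
      \<and> x ` {..<v} \<inter> W \<noteq> {}}"
  let ?P = "{(x, y) \<in> ?X \<times> ?X.
      path_edges v x - all_edges W = path_edges v y - all_edges W \<and> \<not> path_edges v x \<subseteq> all_edges W}"
  have card: "card (path_edges v x) = v - 1" if "x \<in> ?X" for x
  proof -
    have inj: "inj_on x {..<v}" using that by (simp add: embeddings_def)
    have "inj_on (\<lambda>i. {x i, x (Suc i)}) {i. Suc i < v}"
    proof (rule inj_onI)
      fix i j assume ij: "i \<in> {i. Suc i < v}" "j \<in> {i. Suc i < v}" "{x i, x (Suc i)} = {x j, x (Suc j)}"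
      then have "i = j \<or> i = Suc j \<and> Suc i = j"
        using inj by (auto simp: doubleton_eq_iff inj_on_eq_iff)
      then show "i = j" by auto
    qed
    then have "card (path_edges v x) = card {i. Suc i < v}"
      unfolding path_edges_def by (rule card_image)
    also have "{i. Suc i < v} = {..<v - 1}" by auto
    finally show ?thesis by simp
  qed
  have "?P \<subseteq> ?same \<union> ?over"
  proof (rule subsetI, rule UnCI)
    fix z assume "z \<in> ?P" "z \<notin> ?over"
    then obtain x y where z: "z = (x, y)" and x: "x \<in> ?X" and y: "y \<in> ?X"
      and same: "path_edges v x - all_edges W = path_edges v y - all_edges W"
      and disj: "x ` {..<v} \<inter> W = {}"
      by blast
    have "path_edges v x \<inter> all_edges W = {}"
      using disj Union_path_edges[OF v, of x] by (fastforce simp: all_edges_def card_2_iff)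
    then have "path_edges v x \<subseteq> path_edges v y" using same by blast
    moreover have "finite (path_edges v y)"
      by (rule finite_subset[OF path_edges_subset[OF y] finite_all_edges[OF V(1)]])
    ultimately have "path_edges v x = path_edges v y"
      by (intro card_subset_eq) (simp_all only: card[OF x] card[OF y])
    then show "z \<in> ?same" using x y z by simp
  qed
  then have "card ?P \<le> card (?same \<union> ?over)"
    using finite_embeddings[OF V(1), of v]
    by (intro card_mono) (auto intro: finite_subset[of _ "?X \<times> ?X"])
  also have "\<dots> \<le> card ?same + card ?over" by (rule card_Un_le)
  also have "\<dots> \<le> v * card V ^ v + (4 * v) ^ v * card W ^ (2 * v - 1)"
    by (intro add_mono card_same_path_le card_overlapping_paths_le assms)
  finally show ?thesis .
qed

section \<open>Polynomials in the edge indicators\<close>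

definition polynomial_of_degree_le ::
  "'v set \<Rightarrow> nat \<Rightarrow> (('v \<Rightarrow> real) \<Rightarrow> real) \<Rightarrow> bool" where
  "polynomial_of_degree_le V d f \<longleftrightarrow>
     (\<exists>q. mv_vars q \<subseteq> V \<and> mv_degree q \<le> d \<and> (\<forall>x. mv_eval q x = f x))"

lemma mv_eval_superset:
  assumes "finite A" "Poly_Mapping.keys q \<subseteq> A"
  shows "mv_eval q x = (\<Sum>m\<in>A. Poly_Mapping.lookup q m *
     (\<Prod>v\<in>Poly_Mapping.keys m. x v ^ Poly_Mapping.lookup m v))"
  unfolding mv_eval_def using assms by (intro sum.mono_neutral_left) (auto simp: in_keys_iff)

lemma mv_eval_add: "mv_eval (p + q) x = mv_eval p x + mv_eval q x"
proof -
  let ?A = "Poly_Mapping.keys p \<union> Poly_Mapping.keys q"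
  have "Poly_Mapping.keys (p + q) \<subseteq> ?A" by (rule Poly_Mapping.keys_add)
  then show ?thesis
    using mv_eval_superset[of ?A "p + q" x] mv_eval_superset[of ?A p x] mv_eval_superset[of ?A q x]
    by (simp add: lookup_add algebra_simps sum.distrib)
qed

lemma mv_degree_le_iff:
  "mv_degree q \<le> d \<longleftrightarrow>
     (\<forall>m\<in>Poly_Mapping.keys q. (\<Sum>v\<in>Poly_Mapping.keys m. Poly_Mapping.lookup m v) \<le> d)"
  unfolding mv_degree_def by (subst Max_le_iff) auto

lemma polynomial_add:
  assumes "polynomial_of_degree_le V d f" "polynomial_of_degree_le V d g"
  shows "polynomial_of_degree_le V d (\<lambda>x. f x + g x)"
proof -
  obtain p q where p: "mv_vars p \<subseteq> V" "mv_degree p \<le> d" "\<And>x. mv_eval p x = f x"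
    and q: "mv_vars q \<subseteq> V" "mv_degree q \<le> d" "\<And>x. mv_eval q x = g x"
    using assms unfolding polynomial_of_degree_le_def by auto
  have "mv_vars (p + q) \<subseteq> V"
    using p(1) q(1) Poly_Mapping.keys_add[of p q] unfolding mv_vars_def by blast
  moreover have "mv_degree (p + q) \<le> d"
    using p(2) q(2) Poly_Mapping.keys_add[of p q] unfolding mv_degree_le_iff by blast
  ultimately show ?thesis
    unfolding polynomial_of_degree_le_def using p(3) q(3) by (intro exI[of _ "p + q"]) (simp add: mv_eval_add)
qed

lemma polynomial_zero: "polynomial_of_degree_le V d (\<lambda>x. 0)"
  unfolding polynomial_of_degree_le_def
  by (intro exI[of _ 0]) (simp add: mv_vars_def mv_degree_le_iff mv_eval_def)

lemma polynomial_sum: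
  "(\<And>i. i \<in> A \<Longrightarrow> polynomial_of_degree_le V d (f i)) \<Longrightarrow>
   polynomial_of_degree_le V d (\<lambda>x. \<Sum>i\<in>A. f i x)"
  by (induction A rule: infinite_finite_induct) (auto intro: polynomial_zero polynomial_add)

lemma polynomial_monomial:
  assumes "finite T" "T \<subseteq> V" "card T \<le> d"
  shows "polynomial_of_degree_le V d (\<lambda>x. c * (\<Prod>v\<in>T. x v))"
proof -
  define m :: "_ \<Rightarrow>\<^sub>0 nat" where "m = Abs_poly_mapping (\<lambda>v. of_bool (v \<in> T))"
  have m: "Poly_Mapping.lookup m v = of_bool (v \<in> T)" for v
    unfolding m_def using assms(1) by (subst lookup_Abs_poly_mapping) auto
  have keys: "Poly_Mapping.keys m = T" by (auto simp: in_keys_iff m)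
  have deg: "(\<Sum>v\<in>T. Poly_Mapping.lookup m v) = card T" by (simp add: m)
  have "(\<Prod>v\<in>T. x v ^ Poly_Mapping.lookup m v) = (\<Prod>v\<in>T. x v)" for x :: "_ \<Rightarrow> real"
    by (intro prod.cong) (auto simp: m)
  then show ?thesis
    unfolding polynomial_of_degree_le_def using assms keys deg
    by (intro exI[of _ "Poly_Mapping.single m c"])
       (auto simp: mv_vars_def mv_degree_le_iff mv_eval_def)
qed

text \<open>Expanding the product over \<open>S\<close> gives one multilinear monomial for each subset of \<open>S\<close>.\<close>

lemma polynomial_prod_signs:
  assumes "finite S" "S \<subseteq> V" "card S \<le> d"
  shows "polynomial_of_degree_le V d (\<lambda>x. \<Prod>e\<in>S. 2 * x e - 1)"
proof -
  have "(\<Prod>e\<in>S. 2 * x e - 1) = (\<Sum>T\<in>Pow S. (2 ^ card T * (- 1) ^ card (S - T)) * (\<Prod>e\<in>T. x e))"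
    for x :: "_ \<Rightarrow> real"
    using prod_add[OF assms(1), of "\<lambda>e. 2 * x e" "\<lambda>_. - 1"]
    by (simp add: prod.distrib mult.commute mult.left_commute)
  moreover have "polynomial_of_degree_le V d (\<lambda>x. \<Sum>T\<in>Pow S.
      (2 ^ card T * (- 1) ^ card (S - T)) * (\<Prod>e\<in>T. x e))"
  proof (intro polynomial_sum polynomial_monomial)
    fix T assume "T \<in> Pow S"
    then show "finite T" "T \<subseteq> V" "card T \<le> d"
      using assms card_mono[of S T] finite_subset[of T S] by auto
  qed
  ultimately show ?thesis by simp
qed

section \<open>Separation by path counts\<close>

lemma embeddings_inside:
  assumes "W \<subseteq> V" "v \<ge> 2"
  shows "{x \<in> embeddings v V. path_edges v x \<subseteq> all_edges W} = embeddings v W"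
proof (intro equalityI subsetI)
  fix x assume "x \<in> {x \<in> embeddings v V. path_edges v x \<subseteq> all_edges W}"
  then have x: "x \<in> embeddings v V" and "path_edges v x \<subseteq> all_edges W" by auto
  then have "\<Union>(path_edges v x) \<subseteq> W" by (auto simp: all_edges_def)
  then have "x ` {..<v} \<subseteq> W" by (simp only: Union_path_edges[OF assms(2)])
  with x show "x \<in> embeddings v W" by (auto simp: embeddings_def PiE_iff)
next
  fix x assume x: "x \<in> embeddings v W"
  then have "x \<in> embeddings v V" using assms(1) by (auto simp: embeddings_def PiE_iff)
  with path_edges_subset[OF x] show "x \<in> {x \<in> embeddings v V. path_edges v x \<subseteq> all_edges W}" by simp
qed

lemma path_count_gnp:
  assumes "v \<ge> 2"
  shows "measure_pmf.expectation (gnp n (1/2)) (path_count v n) = 0"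
    and "measure_pmf.variance (gnp n (1/2)) (path_count v n) \<le> real (v * n ^ v)"
proof -
  let ?X = "embeddings v {1..n}"
  have X: "finite ?X" by (simp add: finite_embeddings)
  have f: "path_count v n = (\<lambda>G. \<Sum>x\<in>?X. chi (1/2) (path_edges v x) G)"
    by (simp add: fun_eq_iff path_count_def)
  have sub: "\<And>x. x \<in> ?X \<Longrightarrow> path_edges v x \<subseteq> all_edges {1..n}"
    by (rule path_edges_subset)
  show "measure_pmf.expectation (gnp n (1/2)) (path_count v n) = 0"
    unfolding f by (rule variance_sum_chi_gnp(1)[OF X sub path_edges_nonempty[OF assms]])
  have "card {(x, y) \<in> ?X \<times> ?X. path_edges v x = path_edges v y} \<le> v * n ^ v"
    using card_same_path_le[of "{1..n}" v] assms by simp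
  moreover have "measure_pmf.variance (gnp n (1/2)) (path_count v n)
      = real (card {(x, y) \<in> ?X \<times> ?X. path_edges v x = path_edges v y})"
    unfolding f by (rule variance_sum_chi_gnp(2)[OF X sub path_edges_nonempty[OF assms]])
  ultimately show "measure_pmf.variance (gnp n (1/2)) (path_count v n) \<le> real (v * n ^ v)"
    by (simp only: of_nat_le_iff)
qed

text \<open>A labelled path contributes to the mean precisely when it lies inside the clique, so the conditional
  mean is the falling factorial of \<open>k\<close>, whatever the placement.\<close>

lemma path_count_planted_clique:
  assumes "v \<ge> 2" "1 \<le> k" "k \<le> n" "n \<le> k\<^sup>2"
  shows "measure_pmf.expectation (planted_clique n (1/2) k) (path_count v n) \<ge> real (k - v) ^ v"
    and "measure_pmf.variance (planted_clique n (1/2) k) (path_count v n)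
      \<le> real (v * n ^ v + (4 * v) ^ v * k ^ (2 * v - 1))"
proof -
  let ?X = "embeddings v {1..n}"
  have X: "finite ?X" by (simp add: finite_embeddings)
  have sub: "\<And>x. x \<in> ?X \<Longrightarrow> path_edges v x \<subseteq> all_edges {1..n}"
    by (rule path_edges_subset)
  define \<mu> where "\<mu> = real (\<Prod>i\<in>{0..<v}. k - i)"
  have E: "measure_pmf.expectation (gnp n (1/2)) (\<lambda>G. path_count v n (\<lambda>e. G e \<or> e \<in> all_edges W)) = \<mu>"
    if W: "W \<subseteq> {1..n}" "card W = k" for W
  proof -
    have "finite W" by (rule finite_subset[OF W(1)]) simp
    then have "card (embeddings v W) = (\<Prod>i\<in>{0..<v}. k - i)"
      using W(2) by (simp only: card_embeddings)
    moreover have "measure_pmf.expectation (gnp n (1/2))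
        (\<lambda>G. path_count v n (\<lambda>e. G e \<or> e \<in> all_edges W)) = real (card (embeddings v W))"
      unfolding path_count_def embeddings_inside[OF W(1) assms(1), symmetric]
      by (rule expectation_sum_chi_planted[OF X sub])
    ultimately show ?thesis by (simp only: \<mu>_def)
  qed
  have V: "measure_pmf.variance (gnp n (1/2)) (\<lambda>G. path_count v n (\<lambda>e. G e \<or> e \<in> all_edges W))
      \<le> real (v * n ^ v + (4 * v) ^ v * k ^ (2 * v - 1))"
    if W: "W \<subseteq> {1..n}" "card W = k" for W
  proof -
    have "W \<noteq> {}" using W(2) assms(2) by auto
    then have "card {(x, y) \<in> ?X \<times> ?X. path_edges v x - all_edges W = path_edges v y - all_edges W
          \<and> \<not> path_edges v x \<subseteq> all_edges W}
        \<le> v * n ^ v + (4 * v) ^ v * k ^ (2 * v - 1)"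
      using card_path_pairs_le[of "{1..n}" W v] W assms by simp
    moreover have "measure_pmf.variance (gnp n (1/2)) (\<lambda>G. path_count v n (\<lambda>e. G e \<or> e \<in> all_edges W))
        = real (card {(x, y) \<in> ?X \<times> ?X. path_edges v x - all_edges W = path_edges v y - all_edges W
          \<and> \<not> path_edges v x \<subseteq> all_edges W})"
      unfolding path_count_def by (rule variance_sum_chi_planted[OF X sub])
    ultimately show ?thesis by (simp only: of_nat_le_iff)
  qed
  have "real (k - v) ^ v \<le> \<mu>"
    using card_embeddings_ge[of "{..<k}" v] card_embeddings[of "{..<k}" v]
    unfolding \<mu>_def by (metis card_lessThan finite_lessThan of_nat_le_iff of_nat_power)
  also have "\<mu> = measure_pmf.expectation (planted_clique n (1/2) k) (path_count v n)"
    using expectation_planted_clique_eq[OF assms(3) E] by simp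
  finally show "measure_pmf.expectation (planted_clique n (1/2) k) (path_count v n) \<ge> real (k - v) ^ v" .
  show "measure_pmf.variance (planted_clique n (1/2) k) (path_count v n)
      \<le> real (v * n ^ v + (4 * v) ^ v * k ^ (2 * v - 1))"
    by (rule variance_planted_clique_le[OF assms(3) E V])
qed

text \<open>The mean is at least \<open>(k/2) ^ v\<close>. Against its square \<open>(k\<^sup>2/4) ^ v\<close>, the variance term \<open>v * n ^ v\<close>
  becomes \<open>v * (4 n / k\<^sup>2) ^ v\<close>, which decays because \<open>8 n \<le> k\<^sup>2\<close>, and the overlap term
  becomes \<open>(16 v) ^ v / k\<close>.\<close>

lemma path_count_noise_to_signal:
  assumes "v \<ge> 2" "2 * v \<le> k" "k \<le> n" "8 * n \<le> k\<^sup>2"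
  defines "a \<equiv> max (sqrt (measure_pmf.variance (planted_clique n (1/2) k) (path_count v n)))
                    (sqrt (measure_pmf.variance (gnp n (1/2)) (path_count v n)))"
    and "b \<equiv> \<bar>measure_pmf.expectation (planted_clique n (1/2) k) (path_count v n)
              - measure_pmf.expectation (gnp n (1/2)) (path_count v n)\<bar>"
  shows "b > 0" and "a / b \<le> sqrt (real v / 2 ^ v + (16 * real v) ^ v / real k)"
proof -
  define B where "B = real (v * n ^ v + (4 * v) ^ v * k ^ (2 * v - 1))"
  have k: "1 \<le> k" "n \<le> k\<^sup>2" using assms by auto
  note P = path_count_planted_clique[OF assms(1) k(1) assms(3) k(2)]
  note Q = path_count_gnp[OF assms(1), of n]
  have "real (v * n ^ v) \<le> B" unfolding B_def of_nat_le_iff by simp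
  from order_trans[OF Q(2) this] P(2)[folded B_def] have a: "a \<le> sqrt B"
    unfolding a_def by (intro max.boundedI real_sqrt_le_mono)
  have "(real k / 2) ^ v \<le> real (k - v) ^ v"
    using assms(2) by (intro power_mono) (auto simp: of_nat_diff)
  also have "\<dots> \<le> b" unfolding b_def Q(1) using P(1) by linarith
  finally have b: "(real k / 2) ^ v \<le> b" .
  have pos: "(real k / 2) ^ v > 0" using k(1) by simp
  with b show "b > 0" by linarith
  have "B / ((real k / 2) ^ v)\<^sup>2 \<le> real v / 2 ^ v + (16 * real v) ^ v / real k"
  proof -
    have sq: "((real k / 2) ^ v)\<^sup>2 = ((real k)\<^sup>2 / 4) ^ v"
      by (simp add: power2_eq_square flip: power_mult_distrib)
    have "real n ^ v / ((real k)\<^sup>2 / 4) ^ v = (real n / ((real k)\<^sup>2 / 4)) ^ v"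
      by (simp only: power_divide)
    also have "\<dots> \<le> (1 / 2) ^ v"
    proof (intro power_mono)
      have "8 * real n \<le> (real k)\<^sup>2" using assms(4) by (metis of_nat_le_iff of_nat_mult of_nat_numeral of_nat_power)
      then show "real n / ((real k)\<^sup>2 / 4) \<le> 1 / 2" using k(1) by (simp add: field_simps)
    qed simp
    finally have 1: "real v * (real n ^ v / ((real k)\<^sup>2 / 4) ^ v) \<le> real v * (1 / 2) ^ v"
      by (rule mult_left_mono) simp
    have "2 * v = Suc (2 * v - 1)" using assms(1) by simp
    then have "((real k)\<^sup>2 / 4) ^ v = real k * real k ^ (2 * v - 1) / 4 ^ v"
      by (metis power_divide power_mult power_Suc)
    moreover have "x * z / (r * z / y) = x * y / r" if "z \<noteq> 0" "r \<noteq> 0" "y \<noteq> 0" for x y z r :: real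
      using that by (simp add: field_simps)
    ultimately have "(4 * real v) ^ v * real k ^ (2 * v - 1) / ((real k)\<^sup>2 / 4) ^ v
        = (4 * real v) ^ v * 4 ^ v / real k"
      using k(1) by simp
    also have "(4 * real v) ^ v * 4 ^ v = (4 * real v * 4) ^ v"
      by (simp only: power_mult_distrib)
    also have "4 * real v * 4 = 16 * real v" by simp
    finally have 2: "(4 * real v) ^ v * real k ^ (2 * v - 1) / ((real k)\<^sup>2 / 4) ^ v
        = (16 * real v) ^ v / real k" .
    have "B / ((real k / 2) ^ v)\<^sup>2 = real v * (real n ^ v / ((real k)\<^sup>2 / 4) ^ v)
        + (4 * real v) ^ v * real k ^ (2 * v - 1) / ((real k)\<^sup>2 / 4) ^ v"
      unfolding sq by (simp add: B_def add_divide_distrib)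
    also have "\<dots> \<le> real v * (1 / 2) ^ v + (16 * real v) ^ v / real k"
      unfolding 2 using 1 by (rule add_right_mono)
    also have "real v * (1 / 2) ^ v = real v / 2 ^ v" by (simp add: power_one_over)
    finally show ?thesis .
  qed
  then have "sqrt (B / ((real k / 2) ^ v)\<^sup>2) \<le> sqrt (real v / 2 ^ v + (16 * real v) ^ v / real k)"
    by (rule real_sqrt_le_mono)
  then have *: "sqrt B / (real k / 2) ^ v \<le> sqrt (real v / 2 ^ v + (16 * real v) ^ v / real k)"
    using pos by (simp only: real_sqrt_divide real_sqrt_abs abs_of_pos)
  have "a / b \<le> sqrt B / (real k / 2) ^ v"
    using a b pos by (intro frac_le) (simp_all add: B_def)
  with * show "a / b \<le> sqrt (real v / 2 ^ v + (16 * real v) ^ v / real k)" by linarith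
qed

text \<open>The number of vertices must tend to infinity, so that \<open>v / 2 ^ v\<close> vanishes, yet slowly enough that
  \<open>(16 v) ^ v\<close> is negligible against \<open>sqrt n\<close>. The latter would fail for a constant multiple of
  \<open>ln n\<close>.\<close>

definition path_length :: "nat \<Rightarrow> nat" where
  "path_length n = nat \<lfloor>sqrt (ln (real n))\<rfloor>"

lemma path_length_le: "real (path_length n) \<le> sqrt (ln (real n))" 
proof (cases "n = 0")
  case False
  then show ?thesis unfolding path_length_def by simp
qed (simp add: path_length_def)

lemma path_length_at_top: "filterlim path_length at_top sequentially"
  unfolding path_length_def by real_asymp

lemma path_count_error_tendsto_0:
  assumes "\<forall>\<^sub>F n in sequentially. sqrt (real n) \<le> real (k n)"
  shows "(\<lambda>n. sqrt (real (path_length n) / 2 ^ path_length n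
      + (16 * real (path_length n)) ^ path_length n / real (k n))) \<longlonglongrightarrow> 0"
proof -
  have "(\<lambda>v::nat. real v / 2 ^ v) \<longlonglongrightarrow> 0" by real_asymp
  then have 1: "(\<lambda>n. real (path_length n) / 2 ^ path_length n) \<longlonglongrightarrow> 0"
    by (rule filterlim_compose[OF _ path_length_at_top])
  have lim: "(\<lambda>n. (16 * sqrt (ln (real n))) powr sqrt (ln (real n)) / sqrt (real n)) \<longlonglongrightarrow> 0"
    by real_asymp
  have "\<forall>\<^sub>F n in sequentially. 1 \<le> sqrt (ln (real n))" by real_asymp
  with assms have "\<forall>\<^sub>F n in sequentially. (16 * real (path_length n)) ^ path_length n / real (k n)
      \<le> (16 * sqrt (ln (real n))) powr sqrt (ln (real n)) / sqrt (real n)"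
    using eventually_gt_at_top[of 0]
  proof eventually_elim
    case (elim n)
    have "(16 * real (path_length n)) ^ path_length n \<le> (16 * sqrt (ln (real n))) ^ path_length n"
      using path_length_le[of n] by (intro power_mono) auto
    also have "\<dots> = (16 * sqrt (ln (real n))) powr real (path_length n)"
      using elim by (intro powr_realpow[symmetric]) linarith
    also have "\<dots> \<le> (16 * sqrt (ln (real n))) powr sqrt (ln (real n))"
    proof (rule powr_mono[OF path_length_le])
      show "1 \<le> 16 * sqrt (ln (real n))" using elim by linarith
    qed
    finally show ?case using elim by (intro frac_le) auto
  qed
  then have 2: "(\<lambda>n. (16 * real (path_length n)) ^ path_length n / real (k n)) \<longlonglongrightarrow> 0"
    by (intro tendsto_sandwich[OF _ _ tendsto_const lim]) auto
  show ?thesis using tendsto_real_sqrt[OF tendsto_add[OF 1 2]] by simp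
qed

text \<open>Once \<open>C \<ge> 4\<close>, rounding still leaves \<open>k \<ge> 3 * sqrt n\<close> for large \<open>n\<close>, hence \<open>8 n \<le> k\<^sup>2\<close>.\<close>

lemma path_count_strongly_separates:
  assumes "C \<ge> 4" and k: "clique_size C k"
  shows "strongly_separates (\<lambda>n. planted_clique n (1/2) (k n)) (\<lambda>n. gnp n (1/2))
           (\<lambda>n. path_count (path_length n) n)"
proof -
  define a where "a = (\<lambda>n. max (sqrt (measure_pmf.variance (planted_clique n (1/2) (k n))
      (path_count (path_length n) n))) (sqrt (measure_pmf.variance (gnp n (1/2))
      (path_count (path_length n) n))))"
  define b where "b = (\<lambda>n. \<bar>measure_pmf.expectation (planted_clique n (1/2) (k n))
      (path_count (path_length n) n) - measure_pmf.expectation (gnp n (1/2))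
      (path_count (path_length n) n)\<bar>)"
  define g where "g = (\<lambda>n. sqrt (real (path_length n) / 2 ^ path_length n
      + (16 * real (path_length n)) ^ path_length n / real (k n)))"
  have size: "\<bar>real (k n) - C * sqrt (real n)\<bar> < 1" for n
    using k by (simp add: clique_size_def)
  have lower: "4 * sqrt (real n) - 1 \<le> real (k n)" for n
    using size[of n] mult_right_mono[OF assms(1), of "sqrt (real n)"] by linarith
  have "\<forall>\<^sub>F n in sequentially. C * sqrt (real n) + 1 \<le> real n"
    by real_asymp
  moreover have "\<forall>\<^sub>F n in sequentially. 3 * sqrt (real n) \<le> 4 * sqrt (real n) - 1"
    by real_asymp
  moreover have "\<forall>\<^sub>F n in sequentially. 2 * sqrt (ln (real n)) \<le> sqrt (real n)"
    by real_asymp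
  moreover have "\<forall>\<^sub>F n in sequentially. 2 \<le> path_length n"
    using path_length_at_top by (simp add: filterlim_at_top)
  ultimately have ev: "\<forall>\<^sub>F n in sequentially. b n > 0 \<and> a n / b n \<le> g n \<and> sqrt (real n) \<le> real (k n)"
  proof eventually_elim
    case (elim n)
    have three: "3 * sqrt (real n) \<le> real (k n)" using lower[of n] elim by linarith
    then have "(3 * sqrt (real n))\<^sup>2 \<le> (real (k n))\<^sup>2" by (intro power_mono) auto
    then have "real (8 * n) \<le> real ((k n)\<^sup>2)" by (simp add: power_mult_distrib)
    then have "8 * n \<le> (k n)\<^sup>2" by (simp only: of_nat_le_iff)
    moreover have "2 * path_length n \<le> k n"
      using path_length_le[of n] elim three real_sqrt_ge_zero[of "real n"] by linarith
    moreover have "k n \<le> n" using size[of n] elim by linarith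
    ultimately have "b n > 0" "a n / b n \<le> g n"
      unfolding a_def b_def g_def using path_count_noise_to_signal[of "path_length n" "k n" n] elim(4)
      by blast+
    moreover have "sqrt (real n) \<le> real (k n)" using three real_sqrt_ge_zero[of "real n"] by linarith
    ultimately show ?case by blast
  qed
  have "g \<longlonglongrightarrow> 0"
    unfolding g_def using ev by (intro path_count_error_tendsto_0) (auto elim: eventually_mono)
  moreover have "a n \<ge> 0" for n
    unfolding a_def by (simp add: le_max_iff_disj)
  then have "\<forall>\<^sub>F n in sequentially. 0 \<le> a n / b n"
    by (intro always_eventually) (simp add: b_def)
  ultimately have "(\<lambda>n. a n / b n) \<longlonglongrightarrow> 0"
    using ev by (intro tendsto_sandwich[of "\<lambda>_. 0" "\<lambda>n. a n / b n" _ g]) (auto elim: eventually_mono)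
  moreover have "\<forall>\<^sub>F n in sequentially. b n \<noteq> 0"
    using ev by (rule eventually_mono) auto
  ultimately show ?thesis
    unfolding strongly_separates_def Let_def a_def b_def by blast
qed

lemma path_count_polynomial:
  fixes n :: nat
  shows "polynomial_of_degree_le (all_edges {1..n}) v
     (\<lambda>y. \<Sum>x\<in>embeddings v {1..n}. \<Prod>e\<in>path_edges v x. 2 * y e - 1)"
proof (intro polynomial_sum polynomial_prod_signs)
  fix x assume x: "x \<in> embeddings v {1..n}"
  show sub: "path_edges v x \<subseteq> all_edges {1..n}" by (rule path_edges_subset[OF x])
  show "finite (path_edges v x)" by (rule finite_subset[OF sub]) (simp add: finite_all_edges)
  have fin: "finite {i. Suc i < v}" by (rule finite_subset[of _ "{..<v}"]) auto
  have "card (path_edges v x) \<le> card {i. Suc i < v}"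
    unfolding path_edges_def by (rule card_image_le[OF fin])
  also have "\<dots> \<le> card {..<v}" by (intro card_mono) auto
  finally show "card (path_edges v x) \<le> v" by simp
qed

lemma low_degree_polynomial_separates:
  assumes "C \<ge> 4" and "clique_size C k"
  shows "\<exists>q :: nat \<Rightarrow> nat set mvpoly.
           (\<forall>n. mv_vars (q n) \<subseteq> all_edges {1..n})
           \<and> (\<lambda>n. real (mv_degree (q n))) \<in> O(\<lambda>n. ln (real n))
           \<and> strongly_separates (\<lambda>n. planted_clique n (1/2) (k n)) (\<lambda>n. gnp n (1/2))
               (\<lambda>n G. mv_eval (q n) (\<lambda>e. of_bool (G e)))"
proof -
  have "\<exists>q. \<forall>n. mv_vars (q n) \<subseteq> all_edges {1..n} \<and> mv_degree (q n) \<le> path_length n \<and>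
      (\<forall>y. mv_eval (q n) y = (\<Sum>x\<in>embeddings (path_length n) {1..n}.
        \<Prod>e\<in>path_edges (path_length n) x. 2 * y e - 1))"
    using path_count_polynomial unfolding polynomial_of_degree_le_def by (intro choice allI) blast
  then obtain q where vars: "\<And>n. mv_vars (q n) \<subseteq> all_edges {1..n}"
    and deg: "\<And>n. mv_degree (q n) \<le> path_length n"
    and eval: "\<And>n y. mv_eval (q n) y = (\<Sum>x\<in>embeddings (path_length n) {1..n}.
        \<Prod>e\<in>path_edges (path_length n) x. 2 * y e - 1)"
    by blast
  have "real (mv_degree (q n)) \<le> sqrt (ln (real n))" for n
    using deg[of n] path_length_le[of n] by linarith
  then have "(\<lambda>n. real (mv_degree (q n))) \<in> O(\<lambda>n. sqrt (ln (real n)))"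
    by (intro bigoI[of _ 1] always_eventually) (simp add: order_trans[OF _ abs_ge_self])
  also have "(\<lambda>n. sqrt (ln (real n))) \<in> O(\<lambda>n. ln (real n))" by real_asymp
  finally have "(\<lambda>n. real (mv_degree (q n))) \<in> O(\<lambda>n. ln (real n))" .
  moreover have "(\<lambda>n G. mv_eval (q n) (\<lambda>e. of_bool (G e))) = (\<lambda>n. path_count (path_length n) n)"
    by (simp add: fun_eq_iff eval path_count_def chi_half)
  ultimately show ?thesis
    using vars path_count_strongly_separates[OF assms] by (intro exI[of _ q]) auto
qed

theorem lemma4p2:
  "(\<forall>C>0. \<forall>k. clique_size C k \<longrightarrow>
      (\<forall>t. (\<forall>n. t n \<ge> 1) \<longrightarrow>
         \<not> strongly_separates (\<lambda>n. planted_clique n (1/2) (k n)) (\<lambda>n. gnp n (1/2))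
             (\<lambda>n. signed_count n (1/2) (star (t n)))))
   \<and> (\<exists>C0>0. \<forall>C\<ge>C0. \<forall>k. clique_size C k \<longrightarrow>
        (\<exists>q :: nat \<Rightarrow> nat set mvpoly.
           (\<forall>n. mv_vars (q n) \<subseteq> all_edges {1..n})
           \<and> (\<lambda>n. real (mv_degree (q n))) \<in> O(\<lambda>n. ln (real n))
           \<and> strongly_separates (\<lambda>n. planted_clique n (1/2) (k n)) (\<lambda>n. gnp n (1/2))
               (\<lambda>n G. mv_eval (q n) (\<lambda>e. of_bool (G e)))))"
proof (intro conjI)
  show "\<exists>C0>0. \<forall>C\<ge>C0. \<forall>k. clique_size C k \<longrightarrow>
        (\<exists>q :: nat \<Rightarrow> nat set mvpoly.
           (\<forall>n. mv_vars (q n) \<subseteq> all_edges {1..n})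
           \<and> (\<lambda>n. real (mv_degree (q n))) \<in> O(\<lambda>n. ln (real n))
           \<and> strongly_separates (\<lambda>n. planted_clique n (1/2) (k n)) (\<lambda>n. gnp n (1/2))
               (\<lambda>n G. mv_eval (q n) (\<lambda>e. of_bool (G e))))"
    by (intro exI[of _ "4::real"] conjI allI impI low_degree_polynomial_separates) simp_all
qed (intro allI impI star_count_not_strongly_separates; blast)

end
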